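(* The graph $Q$ (defined in the context) is connected and claw-free, but is not a line graph. Moreover, $$[s_{(3,3,3,3,1)}]\,X_Q=-144.$$
   Context: All graphs are finite and simple. The chromatic symmetric function of a graph $G$ is $X_G=\sum_{\kappa}\prod_{u\in V(G)}x_{\kappa(u)}$, where the sum is over all proper colorings $\kappa\colon V(G)\to\mathbb Z_{>0}$. For a partition $\lambda$, $[s_\lambda]X_G$ denotes the coefficient of the Schur function $s_\lambda$ in the Schur expansion of $X_G$. A graph is claw-free if it has no induced subgraph isomorphic to $K_{1,3}$. The line graph $L(H)$ of a (finite simple) graph $H$ has vertex set $E(H)$, two distinct edges being adjacent when they share an endpoint; a graph is a line graph if it is isomorphic to $L(H)$ for some finite simple graph $H$. The graph $H_1$ has vertex set $\{1,\dots,10\}$ and edge set $\{u_1,\dots,u_{12}\}$ with $u_1=\{1,8\}$, $u_2=\{7,10\}$, $u_3=\{2,7\}$, $u_4=\{4,5\}$, $u_5=\{4,9\}$, $u_6=\{3,6\}$, $u_7=\{6,10\}$, $u_8=\{3,10\}$, $u_9=\{5,9\}$, $u_{10}=\{8,10\}$, $u_{11}=\{8,9\}$, $u_{12}=\{7,9\}$. Set $G_1=L(H_1)$, with vertices $u_1,\dots,u_{12}$. The graph $Q$ is obtained from $G_1$ by adding a new vertex $u_{13}$ and the five edges $u_{13}u_4,\ u_{13}u_5,\ u_{13}u_9,\ u_{13}u_{11},\ u_{13}u_{12}$. It has $13$ vertices and $27$ edges. *)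

theory Defs
  imports Main "HOL-Library.FuncSet" "HOL-Library.Poly_Mapping"
begin

section \<open>Finite simple graphs\<close>

datatype 'a graph = Graph (verts: "'a set") (edges: "'a set set")

definition simple_graph :: "'a graph \<Rightarrow> bool" where
  "simple_graph G \<longleftrightarrow> finite (verts G) \<and> (\<forall>e\<in>edges G. e \<subseteq> verts G \<and> card e = 2)"

definition adj_rel :: "'a graph \<Rightarrow> 'a rel" where
  "adj_rel G = {(v, w). {v, w} \<in> edges G}"

definition connected_graph :: "'a graph \<Rightarrow> bool" where
  "connected_graph G \<longleftrightarrow>
     verts G \<noteq> {} \<and> (\<forall>v\<in>verts G. \<forall>w\<in>verts G. (v, w) \<in> (adj_rel G)\<^sup>*)"

definition graph_isomorphic :: "'a graph \<Rightarrow> 'b graph \<Rightarrow> bool" where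
  "graph_isomorphic G H \<longleftrightarrow>
     (\<exists>f. bij_betw f (verts G) (verts H) \<and>
          (\<forall>v\<in>verts G. \<forall>w\<in>verts G. {v, w} \<in> edges G \<longleftrightarrow> {f v, f w} \<in> edges H))"

definition induced_subgraph :: "'a graph \<Rightarrow> 'a set \<Rightarrow> 'a graph" where
  "induced_subgraph G S = Graph S {e \<in> edges G. e \<subseteq> S}"

definition K13 :: "nat graph" where
  "K13 = Graph {0, 1, 2, 3} {{0, 1}, {0, 2}, {0, 3}}"

definition claw_free :: "'a graph \<Rightarrow> bool" where
  "claw_free G \<longleftrightarrow>
     \<not> (\<exists>S. S \<subseteq> verts G \<and> graph_isomorphic (induced_subgraph G S) K13)"

definition line_graph :: "'a graph \<Rightarrow> 'a set graph" where
  "line_graph H =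
     Graph (edges H) {{e, f} | e f. e \<in> edges H \<and> f \<in> edges H \<and> e \<noteq> f \<and> e \<inter> f \<noteq> {}}"

text \<open>HOL cannot quantify over the vertex type of \<open>H\<close>; since every finite graph is
  isomorphic to one with vertices in \<^typ>\<open>nat\<close>, taking \<open>H\<close> over \<^typ>\<open>nat\<close> loses nothing.\<close>

definition is_line_graph :: "'a graph \<Rightarrow> bool" where
  "is_line_graph G \<longleftrightarrow>
     (\<exists>H :: nat graph. simple_graph H \<and> graph_isomorphic G (line_graph H))"

definition add_vertex :: "'a graph \<Rightarrow> 'a \<Rightarrow> 'a set \<Rightarrow> 'a graph" where
  "add_vertex G v N = Graph (insert v (verts G)) (edges G \<union> {{v, w} | w. w \<in> N})"


section \<open>Symmetric functions\<close>

text \<open>A formal power series in \<open>x\<^sub>1, x\<^sub>2, \<dots>\<close> with integer coefficients is the function giving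
  the coefficient of each monomial; a monomial is its finitely supported exponent vector.
  Colours and tableau entries are positive, so the index 0 never occurs as a variable.\<close>

type_synonym monomial = "nat \<Rightarrow>\<^sub>0 nat"
type_synonym power_series = "monomial \<Rightarrow> int"

text \<open>The monomial \<open>\<Prod>a\<in>A. x\<^bsub>f a\<^esub>\<close>, written additively on exponent vectors.\<close>

definition monom_of :: "('a \<Rightarrow> nat) \<Rightarrow> 'a set \<Rightarrow> monomial" where
  "monom_of f A = (\<Sum>a\<in>A. Poly_Mapping.single (f a) 1)"

definition proper_colorings :: "'a graph \<Rightarrow> ('a \<Rightarrow> nat) set" where
  "proper_colorings G =
     {\<kappa> \<in> verts G \<rightarrow>\<^sub>E {0<..}. \<forall>v w. {v, w} \<in> edges G \<longrightarrow> \<kappa> v \<noteq> \<kappa> w}"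

definition chromatic_symmetric_function :: "'a graph \<Rightarrow> power_series" where
  "chromatic_symmetric_function G =
     (\<lambda>m. int (card {\<kappa> \<in> proper_colorings G. monom_of \<kappa> (verts G) = m}))"

definition is_partition :: "nat list \<Rightarrow> bool" where
  "is_partition p \<longleftrightarrow> sorted_wrt (\<ge>) p \<and> 0 \<notin> set p"

definition young_diagram :: "nat list \<Rightarrow> (nat \<times> nat) set" where
  "young_diagram p = {(i, j). i < length p \<and> j < p ! i}"

definition ssyt :: "nat list \<Rightarrow> (nat \<times> nat \<Rightarrow> nat) set" where
  "ssyt p =
     {T \<in> young_diagram p \<rightarrow>\<^sub>E {0<..}.
        (\<forall>i j j'. (i, j) \<in> young_diagram p \<and> (i, j') \<in> young_diagram p \<and> j < j'
           \<longrightarrow> T (i, j) \<le> T (i, j')) \<and>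
        (\<forall>i i' j. (i, j) \<in> young_diagram p \<and> (i', j) \<in> young_diagram p \<and> i < i'
           \<longrightarrow> T (i, j) < T (i', j))}"

definition schur :: "nat list \<Rightarrow> power_series" where
  "schur p = (\<lambda>m. int (card {T \<in> ssyt p. monom_of T (young_diagram p) = m}))"

definition is_schur_expansion :: "power_series \<Rightarrow> (nat list \<Rightarrow>\<^sub>0 int) \<Rightarrow> bool" where
  "is_schur_expansion F c \<longleftrightarrow>
     (\<forall>p \<in> Poly_Mapping.keys c. is_partition p) \<and>
     F = (\<lambda>m. \<Sum>p\<in>Poly_Mapping.keys c. Poly_Mapping.lookup c p * schur p m)"

text \<open>Meaningful when \<open>F\<close> has a Schur expansion, that is, when \<open>F\<close> is a symmetric function;
  the expansion is then unique because Schur functions are linearly independent.\<close>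

definition schur_coeff :: "nat list \<Rightarrow> power_series \<Rightarrow> int" where
  "schur_coeff p F = Poly_Mapping.lookup (THE c. is_schur_expansion F c) p"


section \<open>The graph \<open>Q\<close>\<close>

definition H1 :: "nat graph" where
  "H1 = Graph {1..10}
     {{1, 8}, {7, 10}, {2, 7}, {4, 5}, {4, 9}, {3, 6},
      {6, 10}, {3, 10}, {5, 9}, {8, 10}, {8, 9}, {7, 9}}"

definition G1 :: "nat set graph" where
  "G1 = line_graph H1"

text \<open>The edges of \<^const>\<open>H1\<close> are listed in the order \<open>u\<^sub>1, \<dots>, u\<^sub>1\<^sub>2\<close>.
  The empty set is not an edge of \<^const>\<open>H1\<close>, so it serves as the new vertex \<open>u\<^sub>1\<^sub>3\<close>.
  Its neighbours are \<open>u\<^sub>4, u\<^sub>5, u\<^sub>9, u\<^sub>1\<^sub>1, u\<^sub>1\<^sub>2\<close>.\<close>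

definition Q :: "nat set graph" where
  "Q = add_vertex G1 {} {{4, 5}, {4, 9}, {5, 9}, {8, 9}, {7, 9}}"

end

theory Submission
  imports Defs "HOL-Combinatorics.Transposition" "HOL-Library.Multiset"
begin

text \<open>A symmetric homogeneous power series has a unique Schur expansion because the Schur functions
  are symmetric (Bender--Knuth) and the coefficient of \<open>x\<^sup>q\<close> in \<open>s\<^sub>p\<close> is unitriangular with respect to
  the weight \<open>\<Sum>k. k q\<^sub>k\<close>, which is the entry sum of the tableaux counted by that coefficient. Since \<open>Q\<close>
  is covered by four cliques, no part larger than 4 occurs in the expansion of its chromatic symmetric
  function. Among the partitions with parts at most 4 a single row of the inverse Kostka matrix expresses
  the coefficient of \<open>s\<^sub>3\<^sub>3\<^sub>3\<^sub>3\<^sub>1\<close> as an integer combination of seven monomial coefficients. These are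
  numbers of proper colorings, counted by a search which always chooses the color class of
  the first uncolored vertex. Finally, \<open>Q\<close> is not a line graph because its vertices
  \<open>u\<^sub>4, u\<^sub>5, u\<^sub>9, u\<^sub>1\<^sub>1, u\<^sub>1\<^sub>3\<close> induce the complete graph on five vertices minus an edge.\<close>

section \<open>Monomials and triangularity of Schur functions\<close>

text \<open>\<open>schur_coeff\<close> is a definite description, so it says nothing until the
  expansion is known to exist and to be unique. Uniqueness needs only triangularity. Existence needs
  symmetry as well: coefficients can be fitted at partition monomials only, and symmetry carries the
  agreement to all other monomials. For symmetry, a tableau is read as a chain of shapes whose
  successive differences are horizontal strips. In this form the Bender-Knuth involution reflects
  integers in intervals, and the same recursion, run on lists, computes Kostka numbers. The
  coefficient is obtained without solving for the whole expansion: the weights are chosen so that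
  all other Schur coefficients cancel. Triangularity keeps the check small, because a shape
  contributing to the coefficient of \<open>x^q\<close> has at most as many rows as
  \<open>q\<close>; with five rows and parts at most 4, only nine partitions of 13 are left. The
  colorings are counted by rewriting. This shapes the search and explains why the graph is replaced
  by a table on the indices 0 to 12.\<close>

lemma lookup_monom_of:
  assumes "finite A"
  shows "Poly_Mapping.lookup (monom_of f A) k = card {a \<in> A. f a = k}"
proof -
  have "Poly_Mapping.lookup (monom_of f A) k = (\<Sum>a\<in>A. if f a = k then 1 else 0)"
    by (auto simp: monom_of_def lookup_sum lookup_single when_def intro: sum.cong)
  also have "\<dots> = card {a \<in> A. f a = k}"
    using assms by (simp add: sum.If_cases Int_def)
  finally show ?thesis .
qed

text \<open>The weight is a parameter because two instances are used: \<open>id\<close> gives the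
  entry sum that drives triangularity, and the constant 1 gives the total degree.\<close>

definition weighted_degree :: "(nat \<Rightarrow> nat) \<Rightarrow> monomial \<Rightarrow> nat" where
  "weighted_degree w m = (\<Sum>k\<in>Poly_Mapping.keys m. w k * Poly_Mapping.lookup m k)"

lemma weighted_degree_superset:
  assumes "finite S" "Poly_Mapping.keys m \<subseteq> S"
  shows "weighted_degree w m = (\<Sum>k\<in>S. w k * Poly_Mapping.lookup m k)"
  unfolding weighted_degree_def using assms
  by (intro sum.mono_neutral_left) (auto simp: in_keys_iff)

lemma weighted_degree_monom_of:
  assumes "finite A"
  shows "weighted_degree w (monom_of f A) = (\<Sum>a\<in>A. w (f a))"
proof -
  have "Poly_Mapping.keys (monom_of f A) \<subseteq> f ` A"
    using assms by (auto simp: in_keys_iff lookup_monom_of card_gt_0_iff)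
  then have "weighted_degree w (monom_of f A) = (\<Sum>k\<in>f ` A. w k * card {a \<in> A. f a = k})"
    using assms by (subst weighted_degree_superset[of "f ` A"]) (auto simp: lookup_monom_of)
  also have "\<dots> = (\<Sum>k\<in>f ` A. \<Sum>a\<in>{a \<in> A. f a = k}. w (f a))"
    by (intro sum.cong) (auto simp: mult.commute)
  also have "\<dots> = (\<Sum>a\<in>A. w (f a))"
    using assms by (subst sum.group) auto
  finally show ?thesis .
qed

definition swap_vars :: "nat \<Rightarrow> monomial \<Rightarrow> monomial" where
  "swap_vars i m = Poly_Mapping.map_key (transpose i (Suc i)) m"

lemma lookup_swap_vars:
  "Poly_Mapping.lookup (swap_vars i m) k = Poly_Mapping.lookup m (transpose i (Suc i) k)"
  by (simp add: swap_vars_def map_key.rep_eq)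

lemma swap_vars_swap_vars [simp]: "swap_vars i (swap_vars i m) = m"
  by (rule poly_mapping_eqI) (simp add: lookup_swap_vars)

text \<open>Adjacent swaps suffice to sort an exponent vector, and they are the moves that the
  Bender-Knuth involution supplies. Index 0 is excluded because it is not a variable.\<close>

definition adj_symmetric :: "power_series \<Rightarrow> bool" where
  "adj_symmetric F \<longleftrightarrow> (\<forall>i m. 0 < i \<longrightarrow> F (swap_vars i m) = F m)"

text \<open>Moving the larger exponent to the smaller index lowers the weight by exactly the
  difference of the two exponents.\<close>

lemma weight_swap_vars_less:
  assumes "Poly_Mapping.lookup m i < Poly_Mapping.lookup m (Suc i)"
  shows "weighted_degree id (swap_vars i m) < weighted_degree id m"
proof -
  let ?t = "transpose i (Suc i)" and ?l = "Poly_Mapping.lookup m"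
  \<comment> \<open>A common finite index set for both monomials; away from \<open>i\<close> and
    \<open>Suc i\<close> the two sums agree term by term.\<close>
  define S where "S = Poly_Mapping.keys m \<union> ?t ` Poly_Mapping.keys m \<union> {i, Suc i}"
  define S' where "S' = S - {i, Suc i}"
  have fin: "finite S" "finite S'" and S: "S = insert i (insert (Suc i) S')"
    and ni: "i \<notin> S'" "Suc i \<notin> S'"
    by (auto simp: S_def S'_def)
  have "Poly_Mapping.keys (swap_vars i m) \<subseteq> S"
  proof
    fix k assume "k \<in> Poly_Mapping.keys (swap_vars i m)"
    then have "?t k \<in> Poly_Mapping.keys m" by (simp add: in_keys_iff lookup_swap_vars)
    then have "?t (?t k) \<in> S" unfolding S_def by blast
    then show "k \<in> S" by simp
  qed
  then have "weighted_degree id (swap_vars i m) = (\<Sum>k\<in>S. k * ?l (?t k))"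
    using fin by (subst weighted_degree_superset[of S]) (auto simp: lookup_swap_vars)
  also have "\<dots> = i * ?l (Suc i) + (Suc i * ?l i + (\<Sum>k\<in>S'. k * ?l (?t k)))"
    using fin ni unfolding S by simp
  also have "(\<Sum>k\<in>S'. k * ?l (?t k)) = (\<Sum>k\<in>S'. k * ?l k)"
    using ni by (intro sum.cong) (auto simp: transpose_def)
  also have "i * ?l (Suc i) + (Suc i * ?l i + (\<Sum>k\<in>S'. k * ?l k))
      < i * ?l i + (Suc i * ?l (Suc i) + (\<Sum>k\<in>S'. k * ?l k))"
    using assms by (simp add: algebra_simps)
  also have "\<dots> = (\<Sum>k\<in>S. k * ?l k)"
    using fin ni unfolding S by simp
  also have "\<dots> = weighted_degree id m"
    using fin by (subst weighted_degree_superset[of S]) (auto simp: S_def)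
  finally show ?thesis .
qed

text \<open>The monomial \<open>x^p\<close> is written as the content of the tableau whose row
  \<open>i\<close> is filled with \<open>Suc i\<close> (rows count from 0, variables from 1). Its
  weight can then be compared with that of any tableau of shape \<open>p\<close> cell by
  cell.\<close>

definition part_monom :: "nat list \<Rightarrow> monomial" where
  "part_monom p = monom_of (\<lambda>x. Suc (fst x)) (young_diagram p)"

lemma young_diagram_Sigma: "young_diagram p = (SIGMA i:{..<length p}. {..<p ! i})"
  by (auto simp: young_diagram_def)

lemma finite_young_diagram [simp]: "finite (young_diagram p)"
  by (simp add: young_diagram_Sigma)

lemma card_young_diagram: "card (young_diagram p) = sum_list p"
  by (simp add: young_diagram_Sigma sum_list_sum_nth atLeast0LessThan)

lemma lookup_part_monom:
  "Poly_Mapping.lookup (part_monom p) k =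
     (if 0 < k \<and> k \<le> length p then p ! (k - 1) else 0)"
proof -
  have "{x \<in> young_diagram p. Suc (fst x) = k} =
      (if 0 < k \<and> k \<le> length p then {k - 1} \<times> {..<p ! (k - 1)} else {})"
    by (auto simp: young_diagram_def)
  then show ?thesis
    by (simp add: part_monom_def lookup_monom_of card_cartesian_product)
qed

lemma weighted_degree_part_monom:
  "weighted_degree w (part_monom p) = (\<Sum>x\<in>young_diagram p. w (Suc (fst x)))"
  by (simp add: part_monom_def weighted_degree_monom_of)

lemma part_monom_inject:
  assumes "is_partition p" "is_partition q" "part_monom p = part_monom q"
  shows "p = q"
proof -
  have l: "length q \<le> length p"
    if "is_partition q" "part_monom p = part_monom q" for p q
  proof (rule ccontr)
    assume "\<not> length q \<le> length p"
    moreover have "Poly_Mapping.lookup (part_monom p) (length q) =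
      Poly_Mapping.lookup (part_monom q) (length q)" using that by simp
    ultimately have "q ! (length q - 1) = 0" "length q \<noteq> 0"
      by (auto simp: lookup_part_monom split: if_splits)
    moreover have "q ! (length q - 1) \<in> set q"
      using \<open>length q \<noteq> 0\<close> by simp
    ultimately show False using that(1) by (simp add: is_partition_def)
  qed
  have len: "length p = length q"
    using l[of p q] l[of q p] assms by simp
  moreover have "p ! i = q ! i" if "i < length p" for i
  proof -
    have "Poly_Mapping.lookup (part_monom p) (Suc i) = Poly_Mapping.lookup (part_monom q) (Suc i)"
      using assms by simp
    then show ?thesis using that len by (simp add: lookup_part_monom)
  qed
  ultimately show ?thesis by (rule nth_equalityI)
qed

lemma part_monom_of_antitone:
  assumes "Poly_Mapping.lookup m 0 = 0"
    and anti: "\<And>i. 0 < i \<Longrightarrow> Poly_Mapping.lookup m (Suc i) \<le> Poly_Mapping.lookup m i"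
  shows "\<exists>p. is_partition p \<and> m = part_monom p"
proof -
  let ?l = "\<lambda>i. Poly_Mapping.lookup m (Suc i)"
  have mono: "?l j \<le> ?l i" if "i \<le> j" for i j
    using that
  proof (induction rule: dec_induct)
    case (step j)
    then show ?case using anti[of "Suc j"] by simp
  qed simp
  have "\<exists>i. ?l i = 0"
  proof -
    have "finite (Suc -` Poly_Mapping.keys m)" by (simp add: finite_vimageI)
    then obtain n where "n \<notin> Suc -` Poly_Mapping.keys m"
      using ex_new_if_finite[OF infinite_UNIV_nat] by blast
    then show ?thesis by (auto simp: in_keys_iff)
  qed
  define n where "n = (LEAST i. ?l i = 0)"
  have n0: "?l n = 0" unfolding n_def using \<open>\<exists>i. ?l i = 0\<close> by (rule LeastI_ex)
  have pos: "?l i \<noteq> 0" if "i < n" for i using that unfolding n_def by (rule not_less_Least)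
  define p where "p = map ?l [0..<n]"
  have "is_partition p"
    using mono pos by (force simp: is_partition_def p_def sorted_wrt_iff_nth_less)
  moreover have "m = part_monom p"
  proof (rule poly_mapping_eqI)
    fix k show "Poly_Mapping.lookup m k = Poly_Mapping.lookup (part_monom p) k"
    proof (cases k)
      case 0 then show ?thesis using assms by (simp add: lookup_part_monom)
    next
      case (Suc i)
      have "?l i = 0" if "n \<le> i" using mono[OF that] n0 by simp
      then show ?thesis using Suc by (auto simp: lookup_part_monom p_def)
    qed
  qed
  ultimately show ?thesis by blast
qed

text \<open>Bubble sort: while some exponent is smaller than its successor, swapping the two
  preserves both values and lowers the weight. The process ends at a weakly decreasing exponent
  vector, which is a partition monomial.\<close>

lemma adj_symmetric_eqI:
  assumes "adj_symmetric F" "adj_symmetric G"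
    and "\<And>p. is_partition p \<Longrightarrow> F (part_monom p) = G (part_monom p)"
    and "Poly_Mapping.lookup m 0 = 0"
  shows "F m = G m"
  using assms(4)
proof (induction "weighted_degree id m" arbitrary: m rule: less_induct)
  case less
  show ?case
  proof (cases "\<exists>i>0. Poly_Mapping.lookup m i < Poly_Mapping.lookup m (Suc i)")
    case True
    then obtain i where i: "0 < i" "Poly_Mapping.lookup m i < Poly_Mapping.lookup m (Suc i)" by blast
    have "F (swap_vars i m) = G (swap_vars i m)"
      using less i by (intro less(1) weight_swap_vars_less) (auto simp: lookup_swap_vars transpose_def)
    then show ?thesis using assms(1,2) i by (simp add: adj_symmetric_def)
  next
    case False
    then obtain p where "is_partition p" "m = part_monom p"
      using part_monom_of_antitone less.prems by (meson not_less)
    then show ?thesis using assms(3) by blast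
  qed
qed

section \<open>Semistandard tableaux and triangularity\<close>

lemma is_partition_nth_mono:
  assumes "is_partition p" "i \<le> j" "j < length p"
  shows "p ! j \<le> p ! i"
  using assms by (cases "i = j") (auto simp: is_partition_def sorted_wrt_iff_nth_less)

lemma young_diagram_up:
  assumes "is_partition p" "(i, j) \<in> young_diagram p" "i' \<le> i"
  shows "(i', j) \<in> young_diagram p"
  using assms is_partition_nth_mono[OF assms(1,3)] by (auto simp: young_diagram_def)

lemma ssyt_ge_row:
  assumes "is_partition p" "T \<in> ssyt p" "(i, j) \<in> young_diagram p"
  shows "Suc i \<le> T (i, j)"
  using assms(3)
proof (induction i)
  case 0
  then have "T (0, j) \<in> {0<..}" using assms(2) by (auto simp: ssyt_def)
  then show ?case by simp
next
  case (Suc i)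
  have up: "(i, j) \<in> young_diagram p" using young_diagram_up[OF assms(1) Suc.prems] by simp
  then have "T (i, j) < T (Suc i, j)" using assms(2) Suc.prems by (simp add: ssyt_def)
  then show ?case using Suc.IH[OF up] by simp
qed

lemma schur_nonzeroE:
  assumes "schur p m \<noteq> 0"
  obtains T where "T \<in> ssyt p" "m = monom_of T (young_diagram p)"
proof -
  have "{T \<in> ssyt p. monom_of T (young_diagram p) = m} \<noteq> {}"
  proof
    assume "{T \<in> ssyt p. monom_of T (young_diagram p) = m} = {}"
    then show False using assms unfolding schur_def by (simp only: card.empty)
  qed
  then show thesis using that by blast
qed

lemma schur_nonzero_lookup_0:
  assumes "schur p m \<noteq> 0"
  shows "Poly_Mapping.lookup m 0 = 0"
proof -
  obtain T where T: "T \<in> ssyt p" "m = monom_of T (young_diagram p)"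
    using schur_nonzeroE[OF assms] .
  have "{x \<in> young_diagram p. T x = 0} = {}" using T(1) by (fastforce simp: ssyt_def PiE_iff)
  then show ?thesis by (simp add: T(2) lookup_monom_of)
qed

lemma schur_nonzero_degree:
  assumes "schur p m \<noteq> 0"
  shows "weighted_degree (\<lambda>_. 1) m = sum_list p"
proof -
  obtain T where "m = monom_of T (young_diagram p)"
    using schur_nonzeroE[OF assms] by blast
  then show ?thesis by (simp add: weighted_degree_monom_of card_young_diagram)
qed

lemma degree_part_monom: "weighted_degree (\<lambda>_. 1) (part_monom p) = sum_list p"
  by (simp add: weighted_degree_part_monom card_young_diagram)

text \<open>Column strictness makes every entry at least its row number, counted from 1. Both
  weights are sums over the same diagram, so they compare cell by cell, and equal sums leave no cell
  that is strictly larger.\<close>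

lemma ssyt_weight:
  assumes "is_partition p" "T \<in> ssyt p"
  shows "weighted_degree id (part_monom p) \<le> weighted_degree id (monom_of T (young_diagram p))"
    and "weighted_degree id (part_monom p) = weighted_degree id (monom_of T (young_diagram p)) \<Longrightarrow>
      x \<in> young_diagram p \<Longrightarrow> T x = Suc (fst x)"
proof -
  have ge: "Suc (fst x) \<le> T x" if "x \<in> young_diagram p" for x
    using ssyt_ge_row[OF assms] that by (cases x) auto
  show "weighted_degree id (part_monom p) \<le> weighted_degree id (monom_of T (young_diagram p))"
    by (simp add: weighted_degree_part_monom weighted_degree_monom_of)
      (intro sum_mono ge, simp)
  assume eq: "weighted_degree id (part_monom p) = weighted_degree id (monom_of T (young_diagram p))"
    and x: "x \<in> young_diagram p"
  show "T x = Suc (fst x)"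
  proof (rule ccontr)
    assume "T x \<noteq> Suc (fst x)"
    then have "Suc (fst x) < T x" using ge[OF x] by simp
    then have "(\<Sum>x\<in>young_diagram p. Suc (fst x)) < (\<Sum>x\<in>young_diagram p. T x)"
      using ge x by (intro sum_strict_mono_ex1) auto
    then show False using eq by (simp add: weighted_degree_part_monom weighted_degree_monom_of)
  qed
qed

text \<open>The weight is a numerical substitute for the dominance order, and the later inductions
  over partitions run on it.\<close>

lemma schur_triangular:
  assumes "is_partition p" "schur p m \<noteq> 0"
  shows "m = part_monom p \<or> weighted_degree id (part_monom p) < weighted_degree id m"
proof -
  obtain T where T: "T \<in> ssyt p" "m = monom_of T (young_diagram p)"
    using schur_nonzeroE[OF assms(2)] .
  show ?thesis
  proof (cases "weighted_degree id (part_monom p) = weighted_degree id m")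
    case True
    then have "m = part_monom p"
      using ssyt_weight(2)[OF assms(1) T(1)] T(2)
      by (auto simp: part_monom_def monom_of_def intro!: sum.cong)
    then show ?thesis ..
  next
    case False
    then show ?thesis using ssyt_weight(1)[OF assms(1) T(1)] T(2) by simp
  qed
qed

lemma schur_diagonal:
  assumes "is_partition p"
  shows "schur p (part_monom p) = 1"
proof -
  let ?T = "restrict (\<lambda>x. Suc (fst x)) (young_diagram p)"
  have "{T \<in> ssyt p. monom_of T (young_diagram p) = part_monom p} = {?T}"
  proof (intro equalityI subsetI)
    fix T assume "T \<in> {T \<in> ssyt p. monom_of T (young_diagram p) = part_monom p}"
    then have T: "T \<in> ssyt p" "monom_of T (young_diagram p) = part_monom p" by auto
    have "T = ?T"
    proof (rule extensionalityI[of _ "young_diagram p"])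
      show "T \<in> extensional (young_diagram p)" using T by (auto simp: ssyt_def PiE_iff)
    qed (use ssyt_weight(2)[OF assms T(1)] T(2) in auto)
    then show "T \<in> {?T}" by simp
  next
    fix T assume "T \<in> {?T}"
    then show "T \<in> {T \<in> ssyt p. monom_of T (young_diagram p) = part_monom p}"
      by (auto simp: ssyt_def part_monom_def monom_of_def intro!: sum.cong)
  qed
  then show ?thesis by (simp add: schur_def)
qed

text \<open>Two fragments of dominance: the first cell of the last row of \<open>p\<close> holds an
  entry of at least \<open>length p\<close>, and all entries 1 lie in the top row. The first
  fragment bounds the number of rows in the final computation; the second gives the closure property
  under which shapes with a large first part can be discarded.\<close>

lemma schur_part_monom_nonzero:
  assumes "is_partition p" "schur p (part_monom q) \<noteq> 0"
  shows "length p \<le> length q" "q \<noteq> [] \<Longrightarrow> 0 < hd q \<Longrightarrow> p \<noteq> [] \<and> hd q \<le> hd p"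
proof -
  obtain T where T: "T \<in> ssyt p" "part_monom q = monom_of T (young_diagram p)"
    using schur_nonzeroE[OF assms(2)] .
  have key: "card {x \<in> young_diagram p. T x = k} =
      (if 0 < k \<and> k \<le> length q then q ! (k - 1) else 0)" for k
    using lookup_part_monom[of q k] by (simp add: T(2) lookup_monom_of)
  show "length p \<le> length q"
  proof (cases "p = []")
    case False
    let ?i = "length p - 1"
    have "p ! ?i \<in> set p" using False by simp
    then have "p ! ?i \<noteq> 0" using assms(1) unfolding is_partition_def by metis
    then have x: "(?i, 0) \<in> young_diagram p" using False by (simp add: young_diagram_def)
    have "card {x \<in> young_diagram p. T x = T (?i, 0)} \<noteq> 0" using x by auto
    then have "T (?i, 0) \<le> length q" by (auto simp: key split: if_splits)
    then show ?thesis using ssyt_ge_row[OF assms(1) T(1) x] by simp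
  qed simp
  assume q: "q \<noteq> []" "0 < hd q"
  have "{x \<in> young_diagram p. T x = 1} \<subseteq> {0} \<times> {..<p ! 0}"
  proof
    fix x assume "x \<in> {x \<in> young_diagram p. T x = 1}"
    then show "x \<in> {0} \<times> {..<p ! 0}"
      using ssyt_ge_row[OF assms(1) T(1)] by (cases x) (force simp: young_diagram_def)
  qed
  then have "card {x \<in> young_diagram p. T x = 1} \<le> card ({0::nat} \<times> {..<p ! 0})"
    by (intro card_mono) auto
  then have le: "hd q \<le> p ! 0"
    using q by (auto simp: key card_cartesian_product hd_conv_nth Suc_le_eq)
  show "p \<noteq> [] \<and> hd q \<le> hd p"
  proof (cases "p = []")
    case True
    then have "card {x \<in> young_diagram p. T x = 1} = 0" by (simp add: young_diagram_def)
    then show ?thesis using q by (auto simp: key hd_conv_nth Suc_le_eq)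
  next
    case False
    then show ?thesis using le by (simp add: hd_conv_nth)
  qed
qed

section \<open>Symmetry of Schur functions\<close>

text \<open>Shapes become functions that are eventually zero, so that interlacing conditions between
  neighboring rows need no case split on the number of rows.\<close>

definition diagram :: "(nat \<Rightarrow> nat) \<Rightarrow> (nat \<times> nat) set" where
  "diagram p = {(i, j). j < p i}"

definition is_shape :: "(nat \<Rightarrow> nat) \<Rightarrow> bool" where
  "is_shape p \<longleftrightarrow> antimono p \<and> (\<exists>n. p n = 0)"

definition tableaux :: "nat \<Rightarrow> (nat \<Rightarrow> nat) \<Rightarrow> (nat \<Rightarrow> nat) \<Rightarrow> (nat \<times> nat \<Rightarrow> nat) set" where
  "tableaux k c p = {T \<in> diagram p \<rightarrow>\<^sub>E {1..k}.
     (\<forall>i j j'. j < j' \<and> j' < p i \<longrightarrow> T (i, j) \<le> T (i, j')) \<and>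
     (\<forall>i i' j. i < i' \<and> j < p i' \<longrightarrow> T (i, j) < T (i', j)) \<and>
     (\<forall>j\<in>{1..k}. card {x \<in> diagram p. T x = j} = c j)}"

text \<open>The skew shape \<open>p/q\<close> is a horizontal strip with \<open>m\<close> cells: the
  condition \<open>p (Suc i) \<le> q i\<close> says that no column loses two cells.\<close>

definition strips :: "(nat \<Rightarrow> nat) \<Rightarrow> nat \<Rightarrow> (nat \<Rightarrow> nat) set" where
  "strips p m = {q. (\<forall>i. q i \<le> p i \<and> p (Suc i) \<le> q i) \<and>
     card (diagram p) = card (diagram q) + m}"

lemma is_shape_antimono: "is_shape p \<Longrightarrow> i \<le> j \<Longrightarrow> p j \<le> p i"
  by (simp add: is_shape_def antimono_def)

lemma is_shape_zero:
  assumes "is_shape p" shows "\<exists>n. \<forall>i\<ge>n. p i = 0"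
proof -
  obtain n where "p n = 0" using assms by (auto simp: is_shape_def)
  then have "p i = 0" if "n \<le> i" for i using is_shape_antimono[OF assms that] by simp
  then show ?thesis by blast
qed

lemma diagram_Sigma:
  assumes "\<And>i. n \<le> i \<Longrightarrow> p i = 0"
  shows "diagram p = (SIGMA i:{..<n}. {..<p i})"
proof -
  have "i < n" if "j < p i" for i j
  proof (rule ccontr)
    assume "\<not> i < n"
    then show False using assms[of i] that by simp
  qed
  then show ?thesis by (auto simp: diagram_def)
qed

lemma card_diagram:
  assumes "\<And>i. n \<le> i \<Longrightarrow> p i = 0"
  shows "card (diagram p) = (\<Sum>i<n. p i)"
  by (simp add: diagram_Sigma[OF assms])

lemma finite_diagram:
  assumes "is_shape p" shows "finite (diagram p)"
proof -
  obtain n where "\<forall>i\<ge>n. p i = 0" using is_shape_zero[OF assms] by blast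
  then show ?thesis by (subst diagram_Sigma[of n]) auto
qed

lemma strips_is_shape:
  assumes "is_shape p" "q \<in> strips p m"
  shows "is_shape q"
proof -
  have "q (Suc i) \<le> q i" for i
    using assms(2) by (auto simp: strips_def intro: order_trans[of _ "p (Suc i)"])
  then have "antimono q" by (simp add: antimono_iff_le_Suc)
  obtain n where "p n = 0" using assms by (auto simp: is_shape_def)
  then have "q n = 0" using assms(2) by (metis (mono_tags, lifting) strips_def mem_Collect_eq le_zero_eq)
  then show ?thesis using \<open>antimono q\<close> by (auto simp: is_shape_def)
qed

lemma diagram_mono: "(\<And>i. q i \<le> p i) \<Longrightarrow> diagram q \<subseteq> diagram p"
  by (auto simp: diagram_def intro: less_le_trans)

lemma diagram_inject: "diagram p = diagram q \<Longrightarrow> p = q"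
proof
  fix i assume "diagram p = diagram q"
  then have "{j. (i, j) \<in> diagram p} = {j. (i, j) \<in> diagram q}" by simp
  then have "{..<p i} = {..<q i}" by (simp add: diagram_def lessThan_def)
  then show "p i = q i" by simp
qed

lemma finite_strips:
  assumes "is_shape p" shows "finite (strips p m)"
proof -
  have "diagram ` strips p m \<subseteq> Pow (diagram p)"
    by (intro image_subsetI PowI diagram_mono) (simp add: strips_def)
  then have "finite (diagram ` strips p m)"
    using finite_diagram[OF assms] by (simp add: finite_subset)
  moreover have "inj_on diagram (strips p m)" by (intro inj_onI diagram_inject)
  ultimately show ?thesis by (rule finite_imageD)
qed

section \<open>Deleting and restoring the largest entry of a tableau\<close>

lemma down_closed_nat:
  fixes S :: "nat set"
  assumes "finite S" "\<And>i j. j \<in> S \<Longrightarrow> i < j \<Longrightarrow> i \<in> S"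
  shows "S = {..<card S}"
proof -
  define n where "n = (LEAST n. n \<notin> S)"
  have "\<exists>n. n \<notin> S" using assms(1) ex_new_if_finite infinite_UNIV_nat by blast
  then have n: "n \<notin> S" unfolding n_def by (rule LeastI_ex)
  have "i \<in> S" if "i < n" for i using not_less_Least that unfolding n_def by blast
  moreover have "i < n" if "i \<in> S" for i
    using n assms(2)[OF that] that by (metis linorder_neqE_nat)
  ultimately have "S = {..<n}" by auto
  then show ?thesis by (metis card_lessThan)
qed

text \<open>Forgetting the entries \<open>Suc k\<close> and refilling the removed strip with them
  are inverse operations; \<open>small_shape\<close> and \<open>extend_tableau\<close> provide the
  two directions of the bijection behind \<open>card_tableaux_Suc\<close>.\<close>

definition small_shape :: "nat \<Rightarrow> (nat \<Rightarrow> nat) \<Rightarrow> (nat \<times> nat \<Rightarrow> nat) \<Rightarrow> nat \<Rightarrow> nat" where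
  "small_shape k p T = (\<lambda>i. card {j. j < p i \<and> T (i, j) \<le> k})"

definition extend_tableau ::
  "nat \<Rightarrow> (nat \<Rightarrow> nat) \<Rightarrow> (nat \<Rightarrow> nat) \<Rightarrow> (nat \<times> nat \<Rightarrow> nat) \<Rightarrow> (nat \<times> nat \<Rightarrow> nat)" where
  "extend_tableau k p q T =
     (\<lambda>x. if x \<in> diagram q then T x else if x \<in> diagram p then Suc k else undefined)"

lemma diagram_small_shape:
  assumes "T \<in> tableaux (Suc k) c p"
  shows "diagram (small_shape k p T) = {x \<in> diagram p. T x \<le> k}"
proof -
  have "{j. j < p i \<and> T (i, j) \<le> k} = {..<small_shape k p T i}" for i
    unfolding small_shape_def
  proof (rule down_closed_nat)
    fix j j' assume "j' \<in> {j. j < p i \<and> T (i, j) \<le> k}" "j < j'"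
    moreover from this have "T (i, j) \<le> T (i, j')" using assms by (auto simp: tableaux_def)
    ultimately show "j \<in> {j. j < p i \<and> T (i, j) \<le> k}" by simp
  qed simp
  then have "j < p i \<and> T (i, j) \<le> k \<longleftrightarrow> j < small_shape k p T i" for i j
    by (metis (mono_tags, lifting) lessThan_iff mem_Collect_eq)
  then show ?thesis by (auto simp: diagram_def)
qed

lemma small_shape_strips:
  assumes "is_shape p" "T \<in> tableaux (Suc k) c p"
  shows "small_shape k p T \<in> strips p (c (Suc k))"
proof -
  let ?q = "small_shape k p T"
  note d = diagram_small_shape[OF assms(2)]
  have "?q i \<le> p i" for i
    unfolding small_shape_def by (rule order_trans[OF card_mono[of "{..<p i}"]]) auto
  \<comment> \<open>A cell directly above another cell of \<open>p\<close> has an entry smaller than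
    a value that is at most \<open>Suc k\<close>, so it survives the deletion.\<close>
  moreover have "p (Suc i) \<le> ?q i" for i
  proof -
    have "j < ?q i" if "j < p (Suc i)" for j
    proof -
      have "T (i, j) < T (Suc i, j)" "T (Suc i, j) \<in> {1..Suc k}"
        using assms(2) that by (auto simp: tableaux_def PiE_iff diagram_def)
      moreover have "j < p i" using that is_shape_antimono[OF assms(1), of i "Suc i"] by simp
      ultimately have "(i, j) \<in> diagram ?q" by (simp add: d) (simp add: diagram_def)
      then show ?thesis by (simp add: diagram_def)
    qed
    then show ?thesis by (meson not_less less_irrefl)
  qed
  moreover have "card (diagram p) = card (diagram ?q) + c (Suc k)"
  proof -
    have "diagram p = diagram ?q \<union> {x \<in> diagram p. T x = Suc k}"
      using assms(2) unfolding d by (fastforce simp: tableaux_def PiE_iff)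
    moreover have "diagram ?q \<inter> {x \<in> diagram p. T x = Suc k} = {}" by (auto simp: d)
    moreover have "card {x \<in> diagram p. T x = Suc k} = c (Suc k)"
      using assms(2) by (simp add: tableaux_def)
    ultimately show ?thesis using finite_diagram[OF assms(1)]
      by (metis card_Un_disjoint finite_Un)
  qed
  ultimately show ?thesis by (simp add: strips_def)
qed

lemma restrict_tableaux:
  assumes "is_shape p" "T \<in> tableaux (Suc k) c p"
  shows "restrict T (diagram (small_shape k p T)) \<in> tableaux k c (small_shape k p T)"
proof -
  let ?q = "small_shape k p T"
  note d = diagram_small_shape[OF assms(2)]
  have q: "j < ?q i \<longleftrightarrow> j < p i \<and> T (i, j) \<le> k" for i j
    using d by (auto simp: diagram_def set_eq_iff)
  have shape: "is_shape ?q"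
    using strips_is_shape[OF assms(1) small_shape_strips[OF assms]] .
  have up: "j < ?q i" if "i < i'" "j < ?q i'" for i i' j
    using is_shape_antimono[OF shape, of i i'] that by simp
  have "{x \<in> diagram ?q. restrict T (diagram ?q) x = j} = {x \<in> diagram p. T x = j}"
    if "j \<in> {1..k}" for j
    using that by (auto simp: d)
  then have "card {x \<in> diagram ?q. restrict T (diagram ?q) x = j} = c j" if "j \<in> {1..k}" for j
    using that assms(2) by (simp add: tableaux_def)
  moreover have "restrict T (diagram ?q) \<in> diagram ?q \<rightarrow>\<^sub>E {1..k}"
    using assms(2) by (force simp: tableaux_def PiE_iff d)
  moreover have "restrict T (diagram ?q) (i, j) \<le> restrict T (diagram ?q) (i, j')"
    if "j < j'" "j' < ?q i" for i j j'
  proof -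
    have "j < ?q i" using that by simp
    then show ?thesis
      using that assms(2) by (auto simp: diagram_def tableaux_def q)
  qed
  moreover have "restrict T (diagram ?q) (i, j) < restrict T (diagram ?q) (i', j)"
    if "i < i'" "j < ?q i'" for i i' j
    using that up[OF that] assms(2) by (auto simp: diagram_def tableaux_def q)
  ultimately show ?thesis by (simp add: tableaux_def)
qed

lemma extend_tableaux:
  assumes "is_shape p" "q \<in> strips p (c (Suc k))" "T \<in> tableaux k c q"
  shows "extend_tableau k p q T \<in> tableaux (Suc k) c p"
    and "small_shape k p (extend_tableau k p q T) = q"
    and "restrict (extend_tableau k p q T) (diagram q) = T"
proof -
  let ?T = "extend_tableau k p q T"
  have sub: "diagram q \<subseteq> diagram p" using assms(2) by (intro diagram_mono) (auto simp: strips_def)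
  have shape: "is_shape q" using strips_is_shape[OF assms(1,2)] .
  have Tk: "T x \<in> {1..k}" if "x \<in> diagram q" for x
    using assms(3) that by (auto simp: tableaux_def)
  have small: "?T x \<le> k \<longleftrightarrow> x \<in> diagram q" if "x \<in> diagram p" for x
    using Tk[of x] that by (auto simp: extend_tableau_def)
  have range: "?T x \<in> {1..Suc k}" if "x \<in> diagram p" for x
    using Tk[of x] that by (auto simp: extend_tableau_def)
  show r: "restrict ?T (diagram q) = T"
    using assms(3) by (auto simp: tableaux_def extend_tableau_def PiE_iff restrict_def
        extensional_def fun_eq_iff)
  have "{j. j < p i \<and> ?T (i, j) \<le> k} = {..<q i}" for i
    using small sub by (auto simp: diagram_def subset_iff)
  then show "small_shape k p ?T = q" by (simp add: small_shape_def)
  have "?T \<in> diagram p \<rightarrow>\<^sub>E {1..Suc k}"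
    using range sub by (auto simp: PiE_iff extensional_def extend_tableau_def)
  moreover have "?T (i, j) \<le> ?T (i, j')" if "j < j'" "j' < p i" for i j j'
  proof (cases "j' < q i")
    case True
    then show ?thesis using that assms(3)
      by (auto simp: extend_tableau_def diagram_def tableaux_def)
  next
    case False
    then show ?thesis using that range[of "(i, j)"]
      by (simp add: extend_tableau_def diagram_def)
  qed
  moreover have "?T (i, j) < ?T (i', j)" if "i < i'" "j < p i'" for i i' j
  proof -
    \<comment> \<open>Interlacing forces the upper of two cells in a column into \<open>q\<close>,
      so its entry is at most \<open>k\<close> even when the lower cell is new.\<close>
    have "p i' \<le> p (Suc i)" using that is_shape_antimono[OF assms(1)] by simp
    also have "\<dots> \<le> q i" using assms(2) by (simp add: strips_def)
    finally have jq: "j < q i" using that by simp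
    show ?thesis
    proof (cases "j < q i'")
      case True
      then show ?thesis using that jq assms(3)
        by (auto simp: extend_tableau_def diagram_def tableaux_def)
    next
      case False
      then show ?thesis using that jq Tk[of "(i, j)"]
        by (simp add: extend_tableau_def diagram_def)
    qed
  qed
  moreover have "card {x \<in> diagram p. ?T x = j} = c j" if "j \<in> {1..Suc k}" for j
  proof (cases "j = Suc k")
    case True
    have "{x \<in> diagram p. ?T x = j} = diagram p - diagram q"
      using Tk True by (force simp: extend_tableau_def)
    then show ?thesis
      using assms(2) True sub finite_diagram[OF shape]
      by (simp add: card_Diff_subset strips_def)
  next
    case False
    have "{x \<in> diagram p. ?T x = j} = {x \<in> diagram q. T x = j}"
      using False that sub by (auto simp: extend_tableau_def)
    then show ?thesis using False that assms(3) by (simp add: tableaux_def)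
  qed
  ultimately show "?T \<in> tableaux (Suc k) c p" by (simp add: tableaux_def)
qed

lemma extend_restrict:
  assumes "T \<in> tableaux (Suc k) c p"
  shows "extend_tableau k p (small_shape k p T) (restrict T (diagram (small_shape k p T))) = T"
proof
  fix x
  have "T x = undefined" if "x \<notin> diagram p"
    using assms that by (auto simp: tableaux_def)
  moreover have "T x = Suc k" if "x \<in> diagram p" "\<not> T x \<le> k"
  proof -
    have "T x \<in> {1..Suc k}" using assms that(1) by (auto simp: tableaux_def)
    then show ?thesis using that(2) by simp
  qed
  ultimately show "extend_tableau k p (small_shape k p T)
      (restrict T (diagram (small_shape k p T))) x = T x"
    by (auto simp: extend_tableau_def diagram_small_shape[OF assms])
qed

lemma finite_tableaux: "is_shape p \<Longrightarrow> finite (tableaux k c p)"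
  by (rule finite_subset[of _ "diagram p \<rightarrow>\<^sub>E {1..k}"])
    (auto simp: tableaux_def finite_PiE finite_diagram)

text \<open>Iterated, this presents a tableau as a chain of horizontal strips, that is, as a
  Gelfand-Tsetlin pattern. Both the symmetry proof and the Kostka algorithm rest on it.\<close>

lemma card_tableaux_Suc:
  assumes "is_shape p"
  shows "card (tableaux (Suc k) c p) = (\<Sum>q\<in>strips p (c (Suc k)). card (tableaux k c q))"
proof -
  let ?f = "\<lambda>(q, T). extend_tableau k p q T"
  let ?g = "\<lambda>T. (small_shape k p T, restrict T (diagram (small_shape k p T)))"
  have "bij_betw ?f (Sigma (strips p (c (Suc k))) (tableaux k c)) (tableaux (Suc k) c p)"
  proof (rule bij_betw_byWitness[where f' = ?g])
    show "\<forall>x\<in>Sigma (strips p (c (Suc k))) (tableaux k c). ?g (?f x) = x"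
      using extend_tableaux[OF assms, of _ c k] by auto
    show "\<forall>T\<in>tableaux (Suc k) c p. ?f (?g T) = T"
      by (simp add: extend_restrict)
    show "?f ` Sigma (strips p (c (Suc k))) (tableaux k c) \<subseteq> tableaux (Suc k) c p"
      using extend_tableaux(1)[OF assms, of _ c k] by auto
    show "?g ` tableaux (Suc k) c p \<subseteq> Sigma (strips p (c (Suc k))) (tableaux k c)"
      by (auto simp: small_shape_strips[OF assms] restrict_tableaux[OF assms])
  qed
  then have "card (tableaux (Suc k) c p) = card (Sigma (strips p (c (Suc k))) (tableaux k c))"
    by (simp add: bij_betw_same_card)
  also have "\<dots> = (\<Sum>q\<in>strips p (c (Suc k)). card (tableaux k c q))"
    using finite_strips[OF assms] finite_tableaux[OF strips_is_shape[OF assms]]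
    by (intro card_SigmaI) auto
  finally show ?thesis .
qed

lemma card_tableaux_0:
  assumes "is_shape p"
  shows "card (tableaux 0 c p) = (if p = (\<lambda>_. 0) then 1 else 0)"
proof (cases "p = (\<lambda>_. 0)")
  case True
  then have "diagram p = {}" by (simp add: diagram_def)
  then show ?thesis using True by (simp add: tableaux_def)
next
  case False
  then obtain i where "0 < p i" by auto
  then have "(i, 0) \<in> diagram p" by (simp add: diagram_def)
  then have "tableaux 0 c p = {}" by (auto simp: tableaux_def)
  then show ?thesis using False by simp
qed

text \<open>The reflection of the middle row of a Gelfand--Tsetlin pattern between its neighbouring
  rows, i.e. the Bender--Knuth involution.\<close>

definition toggle :: "(nat \<Rightarrow> nat) \<Rightarrow> (nat \<Rightarrow> nat) \<Rightarrow> (nat \<Rightarrow> nat) \<Rightarrow> nat \<Rightarrow> nat" where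
  "toggle p r q i = max (r i) (p (Suc i)) + (if i = 0 then p 0 else min (p i) (r (i - 1))) - q i"

text \<open>The summands are the lower and upper bounds that interlacing puts on the middle row. The
  lower bound at \<open>i\<close> and the upper bound at \<open>Suc i\<close> are the maximum and
  the minimum of the same two numbers, so together they give \<open>r i + p (Suc i)\<close>; the
  extra minimum completes the last pair.\<close>

lemma sum_toggle_bounds:
  fixes p r :: "nat \<Rightarrow> nat"
  shows "(\<Sum>i<Suc n. max (r i) (p (Suc i)) + (if i = 0 then p 0 else min (p i) (r (i - 1)))) +
      min (p (Suc n)) (r n) = (\<Sum>i<Suc n. r i) + (\<Sum>i<Suc (Suc n). p i)"
proof (induction n)
  case 0
  show ?case by (simp add: max_def min_def)
next
  case (Suc n)
  then show ?case by (simp add: max_def min_def split: if_splits)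
qed

text \<open>With \<open>p\<close> and \<open>r\<close> fixed, interlacing confines each
  \<open>q i\<close> to an interval of its own, so reflecting every entry in its interval is an
  involution. The sizes of \<open>q\<close> and its image add up to those of \<open>p\<close> and
  \<open>r\<close>, and therefore the two strip sizes are exchanged.\<close>

lemma toggle_strips:
  assumes "is_shape p" "q \<in> strips p a" "r \<in> strips q b"
  shows "toggle p r q \<in> strips p b" "r \<in> strips (toggle p r q) a"
    "toggle p r (toggle p r q) = q"
proof -
  let ?lo = "\<lambda>i. max (r i) (p (Suc i))"
  let ?hi = "\<lambda>i. if i = 0 then p 0 else min (p i) (r (i - 1))"
  let ?q = "toggle p r q"
  have pq: "q i \<le> p i" "p (Suc i) \<le> q i" and qr: "r i \<le> q i" "q (Suc i) \<le> r i" for i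
    using assms by (auto simp: strips_def)
  have lo: "?lo i \<le> q i" and hi: "q i \<le> ?hi i" for i
    using pq[of i] qr[of i] qr(2)[of "i - 1"] by auto
  have lo': "?lo i \<le> ?q i" and hi': "?q i \<le> ?hi i" for i
    using lo[of i] hi[of i] unfolding toggle_def by linarith+
  show "toggle p r ?q = q"
  proof
    fix i show "toggle p r ?q i = q i"
      using lo[of i] hi[of i] unfolding toggle_def by linarith
  qed
  have pq': "?q i \<le> p i" "p (Suc i) \<le> ?q i" and qr': "r i \<le> ?q i" "?q (Suc i) \<le> r i" for i
    using lo'[of i] hi'[of i] hi'[of "Suc i"] by (auto split: if_splits)
  obtain n where n: "\<forall>i\<ge>n. p i = 0" using is_shape_zero[OF assms(1)] by blast
  have zero: "p i = 0" "q i = 0" "?q i = 0" "r i = 0" if "n \<le> i" for i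
    using n that pq(1)[of i] pq'(1)[of i] qr(1)[of i] by auto
  have card: "card (diagram f) = (\<Sum>i<Suc n. f i)" if "\<And>i. n \<le> i \<Longrightarrow> f i = 0" for f
    using that by (intro card_diagram) simp
  have "card (diagram q) + card (diagram ?q) = (\<Sum>i<Suc n. q i + ?q i)"
    using zero by (simp only: card sum.distrib)
  also have "\<dots> = (\<Sum>i<Suc n. ?lo i + ?hi i)"
  proof (rule sum.cong)
    fix i show "q i + ?q i = ?lo i + ?hi i"
      using lo[of i] hi[of i] unfolding toggle_def by linarith
  qed simp
  \<comment> \<open>All rows from \<open>n\<close> on are empty, so the unpaired minimum
    vanishes.\<close>
  also have "\<dots> = (\<Sum>i<Suc n. r i) + (\<Sum>i<Suc (Suc n). p i)"
    using sum_toggle_bounds[of r p n] zero by simp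
  also have "\<dots> = card (diagram r) + card (diagram p)"
    using zero by (simp add: card)
  finally have "card (diagram q) + card (diagram ?q) = card (diagram r) + card (diagram p)" .
  then show "?q \<in> strips p b" "r \<in> strips ?q a"
    using assms(2,3) pq' qr' by (auto simp: strips_def)
qed

lemma tableaux_cong:
  "(\<And>j. j \<in> {1..k} \<Longrightarrow> c j = c' j) \<Longrightarrow> tableaux k c p = tableaux k c' p"
  by (simp add: tableaux_def)

text \<open>If \<open>Suc i\<close> is not the largest value, the outermost strip has the same size
  on both sides and induction applies. Otherwise two levels are peeled off and \<open>toggle\<close>
  acts on the shape between them, leaving the inner tableau alone.\<close>

lemma card_tableaux_swap:
  assumes "0 < i" "Suc i \<le> k" "is_shape p"
  shows "card (tableaux k (c \<circ> transpose i (Suc i)) p) = card (tableaux k c p)"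
  using assms(2,3)
proof (induction k arbitrary: p)
  case (Suc k)
  let ?c = "c \<circ> transpose i (Suc i)"
  show ?case
  proof (cases "Suc i \<le> k")
    case True
    then have "?c (Suc k) = c (Suc k)" by (simp add: transpose_def)
    then show ?thesis
      using Suc.IH[OF True] strips_is_shape[OF Suc.prems(2)]
      by (simp add: card_tableaux_Suc Suc.prems)
  next
    case False
    then have k: "k = i" using Suc.prems by simp
    obtain j where j: "i = Suc j" using assms(1) by (cases i) auto
    have eq: "tableaux j ?c r = tableaux j c r" for r
      by (rule tableaux_cong) (auto simp: j transpose_def)
    have expand: "card (tableaux (Suc k) d p) =
       (\<Sum>(q, r)\<in>Sigma (strips p (d (Suc i))) (\<lambda>q. strips q (d i)). card (tableaux j d r))" for d
    proof -
      have "card (tableaux (Suc k) d p) =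
          (\<Sum>q\<in>strips p (d (Suc i)). \<Sum>r\<in>strips q (d i). card (tableaux j d r))"
        unfolding k using strips_is_shape[OF Suc.prems(2)]
        by (simp add: card_tableaux_Suc Suc.prems) (simp add: j card_tableaux_Suc)
      also have "\<dots> = (\<Sum>(q, r)\<in>Sigma (strips p (d (Suc i))) (\<lambda>q. strips q (d i)). card (tableaux j d r))"
        using strips_is_shape[OF Suc.prems(2)]
        by (intro sum.Sigma finite_strips Suc.prems ballI) auto
      finally show ?thesis .
    qed
    have "(\<Sum>(q, r)\<in>Sigma (strips p (?c (Suc i))) (\<lambda>q. strips q (?c i)). card (tableaux j ?c r)) =
        (\<Sum>(q, r)\<in>Sigma (strips p (c (Suc i))) (\<lambda>q. strips q (c i)). card (tableaux j c r))"
      by (rule sum.reindex_bij_witness[where i = "\<lambda>(q, r). (toggle p r q, r)"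
            and j = "\<lambda>(q, r). (toggle p r q, r)"])
        (auto simp: eq toggle_strips[OF Suc.prems(2)])
    then show ?thesis by (simp only: expand)
  qed
qed simp

section \<open>From partitions as lists to row functions\<close>

definition rows :: "nat list \<Rightarrow> nat \<Rightarrow> nat" where
  "rows p i = (if i < length p then p ! i else 0)"

lemma young_diagram_rows: "young_diagram p = diagram (rows p)"
  by (auto simp: young_diagram_def diagram_def rows_def split: if_splits)

lemma is_shape_rows: "sorted_wrt (\<ge>) p \<Longrightarrow> is_shape (rows p)"
  unfolding is_shape_def
  by (auto simp: rows_def sorted_wrt_iff_nth_less antimono_iff_le_Suc)

text \<open>The content alone bounds the entries: a value that occurs has a nonzero exponent, so it
  is at most \<open>k\<close> and different from 0.\<close>

lemma ssyt_eq_tableaux: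
  assumes "is_partition p" "Poly_Mapping.lookup m 0 = 0" "Poly_Mapping.keys m \<subseteq> {..k}"
  shows "{T \<in> ssyt p. monom_of T (young_diagram p) = m} =
    tableaux k (Poly_Mapping.lookup m) (rows p)"
proof (intro equalityI subsetI)
  fix T assume "T \<in> {T \<in> ssyt p. monom_of T (young_diagram p) = m}"
  then have T: "T \<in> ssyt p" "monom_of T (young_diagram p) = m" by auto
  have c: "card {x \<in> young_diagram p. T x = j} = Poly_Mapping.lookup m j" for j
    using T(2) by (simp add: lookup_monom_of flip: T(2))
  have "T x \<in> {1..k}" if "x \<in> young_diagram p" for x
  proof -
    have "card {y \<in> young_diagram p. T y = T x} \<noteq> 0" using that by (subst card_0_eq) (simp, blast)
    then have "Poly_Mapping.lookup m (T x) \<noteq> 0" by (simp add: c)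
    then show ?thesis using assms(2,3) by (cases "T x") (auto simp: in_keys_iff subset_iff)
  qed
  then have "T \<in> young_diagram p \<rightarrow>\<^sub>E {1..k}"
    using T(1) by (auto simp: ssyt_def PiE_iff)
  moreover have "T (i, j) \<le> T (i, j')" if "j < j'" "j' < rows p i" for i j j'
    using T(1) that by (auto simp: ssyt_def young_diagram_rows diagram_def)
  moreover have "T (i, j) < T (i', j)" if "i < i'" "j < rows p i'" for i i' j
  proof -
    have "(i', j) \<in> young_diagram p" using that by (simp add: young_diagram_rows diagram_def)
    then show ?thesis
      using T(1) that young_diagram_up[OF assms(1), of i' j i] by (simp add: ssyt_def)
  qed
  ultimately show "T \<in> tableaux k (Poly_Mapping.lookup m) (rows p)"
    using c by (simp add: tableaux_def flip: young_diagram_rows)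
next
  fix T assume T: "T \<in> tableaux k (Poly_Mapping.lookup m) (rows p)"
  have "T \<in> ssyt p"
    using T by (force simp: tableaux_def ssyt_def young_diagram_rows diagram_def PiE_iff)
  moreover have "monom_of T (young_diagram p) = m"
  proof (rule poly_mapping_eqI)
    fix j
    have "card {x \<in> young_diagram p. T x = j} = Poly_Mapping.lookup m j"
    proof (cases "j \<in> {1..k}")
      case True
      then show ?thesis using T by (simp add: tableaux_def young_diagram_rows)
    next
      case False
      have "T x \<in> {1..k}" if "x \<in> young_diagram p" for x
        using T that by (auto simp: tableaux_def young_diagram_rows)
      then have e: "{x \<in> young_diagram p. T x = j} = {}" using False by blast
      have "Poly_Mapping.lookup m j = 0"
        using False assms(2,3) by (cases j) (auto simp: in_keys_iff subset_iff)
      then show ?thesis unfolding e by simp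
    qed
    then show "Poly_Mapping.lookup (monom_of T (young_diagram p)) j = Poly_Mapping.lookup m j"
      by (simp add: lookup_monom_of)
  qed
  ultimately show "T \<in> {T \<in> ssyt p. monom_of T (young_diagram p) = m}" by simp
qed

lemma schur_adj_symmetric:
  assumes "is_partition p"
  shows "adj_symmetric (schur p)"
  unfolding adj_symmetric_def
proof (intro allI impI)
  fix i :: nat and m :: monomial assume i: "0 < i"
  have z: "Poly_Mapping.lookup (swap_vars i m) 0 = Poly_Mapping.lookup m 0"
    using i by (simp add: lookup_swap_vars transpose_def)
  show "schur p (swap_vars i m) = schur p m"
  proof (cases "Poly_Mapping.lookup m 0 = 0")
    case False
    then show ?thesis using z schur_nonzero_lookup_0 by metis
  next
    case True
    \<comment> \<open>One alphabet \<open>{1..k}\<close> has to serve both monomials and contain the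
      two exchanged values.\<close>
    obtain k where k: "Poly_Mapping.keys m \<union> Poly_Mapping.keys (swap_vars i m) \<union> {Suc i} \<subseteq> {..k}"
      using finite_nat_set_iff_bounded_le[of "Poly_Mapping.keys m \<union> Poly_Mapping.keys (swap_vars i m) \<union> {Suc i}"]
      by auto
    have "Poly_Mapping.lookup (swap_vars i m) = Poly_Mapping.lookup m \<circ> transpose i (Suc i)"
      by (simp add: fun_eq_iff lookup_swap_vars)
    then show ?thesis
      using k z True assms i
      by (simp add: schur_def ssyt_eq_tableaux[of _ _ k] card_tableaux_swap is_shape_rows is_partition_def)
  qed
qed

section \<open>Kostka numbers and Schur expansions\<close>

text \<open>Rows are shortened but never dropped, so results may end in zeros. This is why
  \<open>kostka\<close> tests for zero entries instead of \<open>[]\<close>, and why the lemmas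
  about these lists assume sortedness rather than \<open>is_partition\<close>.\<close>

fun strip_list :: "nat list \<Rightarrow> nat \<Rightarrow> nat list list" where
  "strip_list [] m = (if m = 0 then [[]] else [])"
| "strip_list (p # ps) m =
     concat (map (\<lambda>d. map ((#) (p - d)) (strip_list ps (m - d)))
       [0..<Suc (min m (p - (case ps of [] \<Rightarrow> 0 | q # _ \<Rightarrow> q)))])"

text \<open>Each step strips off the largest remaining entry, so the content is listed from the
  largest value down; hence the \<open>rev\<close> in later statements.\<close>

fun kostka :: "nat list \<Rightarrow> nat list \<Rightarrow> nat" where
  "kostka p [] = (if \<forall>x\<in>set p. x = 0 then 1 else 0)"
| "kostka p (m # ms) = sum_list (map (\<lambda>q. kostka q ms) (strip_list p m))"

lemma rows_Nil: "rows [] = (\<lambda>_. 0)"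
  by (simp add: rows_def fun_eq_iff)

lemma rows_Cons: "rows (a # p) = case_nat a (rows p)"
  by (auto simp: rows_def fun_eq_iff split: nat.split)

lemma rows_0: "rows p 0 = (case p of [] \<Rightarrow> 0 | q # _ \<Rightarrow> q)"
  by (simp add: rows_def split: list.split)

lemma diagram_case_nat:
  "diagram (case_nat a p) = {0} \<times> {..<a} \<union> (\<lambda>(i, j). (Suc i, j)) ` diagram p"
  by (force simp: diagram_def image_iff split: nat.splits)

lemma card_diagram_case_nat:
  assumes "is_shape p"
  shows "card (diagram (case_nat a p)) = a + card (diagram p)"
proof -
  have "inj_on (\<lambda>(i, j). (Suc i, j :: nat)) (diagram p)" by (auto intro: inj_onI)
  then show ?thesis
    unfolding diagram_case_nat using finite_diagram[OF assms]
    by (subst card_Un_disjoint) (auto simp: card_image card_cartesian_product)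
qed

text \<open>The first row can lose at most \<open>a - p 0\<close> cells, because it must still cover
  the old second row. What the other rows lose is an independent strip of the remaining
  size.\<close>

lemma strips_case_nat:
  assumes "is_shape p" "p 0 \<le> a"
  shows "strips (case_nat a p) m =
    (\<lambda>(d, q). case_nat (a - d) q) ` (SIGMA d:{..min m (a - p 0)}. strips p (m - d))"
proof (intro equalityI subsetI)
  fix q assume q: "q \<in> strips (case_nat a p) m"
  define r where "r = (\<lambda>i. q (Suc i))"
  have qr: "q = case_nat (q 0) r" by (auto simp: r_def fun_eq_iff split: nat.split)
  have le: "q i \<le> case_nat a p i" "case_nat a p (Suc i) \<le> q i" for i
    using q by (auto simp: strips_def)
  have q0: "q 0 \<le> a" "p 0 \<le> q 0" using le[of 0] by auto
  have r: "r i \<le> p i \<and> p (Suc i) \<le> r i" for i using le[of "Suc i"] by (simp add: r_def)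
  then have sub: "diagram r \<subseteq> diagram p" by (intro diagram_mono) simp
  \<comment> \<open>Membership with a provisional size shows that \<open>r\<close> is a shape, so
    that cells can be counted; the true size comes out of that count.\<close>
  have "r \<in> strips p (card (diagram p) - card (diagram r))"
    using r card_mono[OF finite_diagram[OF assms(1)] sub] by (simp add: strips_def)
  note shape = strips_is_shape[OF assms(1) this]
  have "a + card (diagram p) = q 0 + card (diagram r) + m"
    using q card_diagram_case_nat[OF assms(1)] card_diagram_case_nat[OF shape, of "q 0"]
    by (simp add: strips_def flip: qr)
  then have "r \<in> strips p (m - (a - q 0))" "a - q 0 \<le> m"
    using r q0 card_mono[OF finite_diagram[OF assms(1)] sub] by (auto simp: strips_def)
  then show "q \<in> (\<lambda>(d, q). case_nat (a - d) q) ` (SIGMA d:{..min m (a - p 0)}. strips p (m - d))"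
    using q0 qr by (intro image_eqI[of _ _ "(a - q 0, r)"]) auto
next
  fix q assume "q \<in> (\<lambda>(d, q). case_nat (a - d) q) ` (SIGMA d:{..min m (a - p 0)}. strips p (m - d))"
  then obtain d r where d: "d \<le> m" "d \<le> a - p 0" and r: "r \<in> strips p (m - d)"
    and q: "q = case_nat (a - d) r" by auto
  have "card (diagram (case_nat a p)) = card (diagram q) + m"
    unfolding q card_diagram_case_nat[OF assms(1)] card_diagram_case_nat[OF strips_is_shape[OF assms(1) r]]
    using r d assms(2) by (simp add: strips_def)
  moreover have "q i \<le> case_nat a p i \<and> case_nat a p (Suc i) \<le> q i" for i
    using r d assms(2) by (cases i) (auto simp: q strips_def)
  ultimately show "q \<in> strips (case_nat a p) m" by (simp add: strips_def)
qed

lemma strips_zero: "strips (\<lambda>_. 0) m = (if m = 0 then {\<lambda>_. 0} else {})"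
proof -
  have "strips (\<lambda>_. 0) m =
      {q. q = (\<lambda>_. 0) \<and> card (diagram (\<lambda>_. 0)) = card (diagram q) + m}"
    by (simp add: strips_def fun_eq_iff)
  also have "\<dots> = {q. q = (\<lambda>_. 0) \<and> m = 0}"
    by (intro Collect_cong conj_cong) simp_all
  finally show ?thesis by simp
qed

lemma sum_list_concat: "sum_list (concat xss) = (\<Sum>xs\<leftarrow>xss. sum_list xs)"
  for xss :: "'a::monoid_add list list"
  by (induction xss) auto

text \<open>The summand is arbitrary so that the induction can absorb the first row into it.
  Comparing sums instead of sets also records that no strip is enumerated twice.\<close>

lemma sum_strips_rows:
  assumes "sorted_wrt (\<ge>) p"
  shows "(\<Sum>q\<in>strips (rows p) m. f q) = (\<Sum>q\<leftarrow>strip_list p m. f (rows q))"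
  using assms
proof (induction p arbitrary: m f)
  case Nil
  show ?case by (simp add: rows_Nil strips_zero)
next
  case (Cons a p)
  then have s: "sorted_wrt (\<ge>) p" and shape: "is_shape (rows p)" by (auto intro: is_shape_rows)
  have le: "rows p 0 \<le> a" using Cons.prems by (auto simp: rows_0 split: list.split)
  let ?S = "SIGMA d:{..min m (a - rows p 0)}. strips (rows p) (m - d)"
  have inj: "inj_on (\<lambda>(d, q). case_nat (a - d) q) ?S"
  proof (rule inj_onI)
    fix x y
    assume x: "x \<in> ?S" and y: "y \<in> ?S"
      and eq: "(\<lambda>(d, q). case_nat (a - d) q) x = (\<lambda>(d, q). case_nat (a - d) q) y"
    obtain d q d' q' where xy: "x = (d, q)" "y = (d', q')" by (cases x, cases y) auto
    have eq: "case_nat (a - d) q = case_nat (a - d') q'" using eq by (simp add: xy)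
    have "a - d = a - d'" using fun_cong[OF eq, of 0] by simp
    moreover have "q i = q' i" for i using fun_cong[OF eq, of "Suc i"] by simp
    ultimately show "x = y" using x y by (auto simp: xy)
  qed
  have "(\<Sum>q\<in>strips (rows (a # p)) m. f q) =
      (\<Sum>(d, q)\<in>?S. f (case_nat (a - d) q))"
    unfolding rows_Cons strips_case_nat[OF shape le] sum.reindex[OF inj]
    by (intro sum.cong) auto
  also have "\<dots> = (\<Sum>d\<le>min m (a - rows p 0). \<Sum>q\<in>strips (rows p) (m - d). f (case_nat (a - d) q))"
    using finite_strips[OF shape] by (intro sum.Sigma[symmetric]) auto
  also have "\<dots> = (\<Sum>d\<leftarrow>[0..<Suc (min m (a - rows p 0))].
      \<Sum>q\<leftarrow>strip_list p (m - d). f (case_nat (a - d) (rows q)))"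
    by (simp only: Cons.IH[OF s] interv_sum_list_conv_sum_set_nat set_upt
        atLeast0LessThan lessThan_Suc_atMost)
  also have "\<dots> = (\<Sum>q\<leftarrow>strip_list (a # p) m. f (rows q))"
    by (simp add: sum_list_concat map_concat rows_Cons rows_0 o_def del: upt_Suc)
  finally show ?case .
qed

lemma strip_list_sorted:
  assumes "sorted_wrt (\<ge>) p" "q \<in> set (strip_list p m)"
  shows "sorted_wrt (\<ge>) q \<and> (\<forall>x\<in>set q. \<exists>y\<in>set p. x \<le> y)"
  using assms
proof (induction p arbitrary: q m)
  case (Cons a p)
  obtain d r where d: "d \<le> a - (case p of [] \<Rightarrow> 0 | q # _ \<Rightarrow> q)"
    and q: "q = (a - d) # r" and r: "r \<in> set (strip_list p (m - d))"
    using Cons.prems(2) by (auto simp: less_Suc_eq_le simp del: upt_Suc)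
  have IH: "sorted_wrt (\<ge>) r" "\<forall>x\<in>set r. \<exists>y\<in>set p. x \<le> y"
    using Cons.IH[OF _ r] Cons.prems(1) by simp_all
  have "y \<le> a - d" if "y \<in> set p" for y
    using Cons.prems(1) d that by (cases p) fastforce+
  then have "\<forall>x\<in>set r. x \<le> a - d" using IH(2) order_trans by blast
  then show ?case using IH q by auto
qed (auto split: if_splits)

lemma card_tableaux_rows:
  assumes "sorted_wrt (\<ge>) p"
  shows "card (tableaux k c (rows p)) = kostka p (map c (rev [1..<Suc k]))"
  using assms
proof (induction k arbitrary: p)
  case 0
  have "rows p = (\<lambda>_. 0) \<longleftrightarrow> (\<forall>x\<in>set p. x = 0)"
    by (auto simp: rows_def fun_eq_iff all_set_conv_all_nth)
  then show ?case using is_shape_rows[OF 0] by (simp add: card_tableaux_0)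
next
  case (Suc k)
  have "card (tableaux (Suc k) c (rows p)) =
      (\<Sum>q\<leftarrow>strip_list p (c (Suc k)). card (tableaux k c (rows q)))"
    by (simp add: card_tableaux_Suc is_shape_rows sum_strips_rows Suc.prems)
  also have "\<dots> = (\<Sum>q\<leftarrow>strip_list p (c (Suc k)). kostka q (map c (rev [1..<Suc k])))"
    using Suc.IH strip_list_sorted[OF Suc.prems]
    by (intro arg_cong[where f = sum_list] map_cong) auto
  finally show ?case by simp
qed

lemma schur_part_monom:
  assumes "is_partition p"
  shows "schur p (part_monom q) = int (kostka p (rev q))"
proof -
  have "map (Poly_Mapping.lookup (part_monom q)) (rev [1..<Suc (length q)]) = rev q"
    by (rule nth_equalityI) (auto simp: rev_nth lookup_part_monom nth_append simp del: upt_Suc)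
  moreover have "Poly_Mapping.keys (part_monom q) \<subseteq> {..length q}"
    by (auto simp: in_keys_iff lookup_part_monom split: if_splits)
  ultimately show ?thesis
    using assms
    by (simp add: schur_def ssyt_eq_tableaux[of _ _ "length q"] lookup_part_monom
        card_tableaux_rows is_partition_def del: upt_Suc)
qed

section \<open>Existence and uniqueness of Schur expansions\<close>

lemma triangular_system:
  fixes f :: "'a \<Rightarrow> int" and w :: "'a \<Rightarrow> nat"
  assumes "finite P" "\<And>x. x \<in> P \<Longrightarrow> K x x = 1"
    and "\<And>x y. x \<in> P \<Longrightarrow> y \<in> P \<Longrightarrow> K x y \<noteq> 0 \<Longrightarrow> x = y \<or> w x < w y"
  shows "\<exists>c. \<forall>y\<in>P. f y = (\<Sum>x\<in>P. c x * K x y)"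
  using assms
proof (induction P rule: finite_ranking_induct[where f = w])
  case (insert x S)
  then obtain c where c: "\<And>y. y \<in> S \<Longrightarrow> f y = (\<Sum>x\<in>S. c x * K x y)"
    by (metis insert_iff)
  \<comment> \<open>The new \<open>x\<close> has maximal rank, so \<open>K x y\<close> vanishes for
    every older \<open>y\<close> and the old equations are undisturbed; the unit diagonal lets the
    coefficient of \<open>x\<close> absorb the defect at \<open>x\<close>.\<close>
  define c' where "c' = c(x := f x - (\<Sum>z\<in>S. c z * K z x))"
  show ?case
  proof (cases "x \<in> S")
    case True
    then show ?thesis using c by (auto simp: insert_absorb)
  next
    case False
    have old: "(\<Sum>z\<in>S. c' z * K z y) = (\<Sum>z\<in>S. c z * K z y)" for y
      using False by (intro sum.cong) (auto simp: c'_def)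
    have "f y = (\<Sum>z\<in>insert x S. c' z * K z y)" if "y \<in> insert x S" for y
    proof (cases "y = x")
      case True
      then show ?thesis using insert False old by (simp add: c'_def)
    next
      case yx: False
      then have "K x y = 0"
        using insert.prems(2)[of x y] insert.hyps(2)[of y] that by force
      then show ?thesis using insert.hyps(1) False yx that c old by simp
    qed
    then show ?thesis by blast
  qed
qed simp

lemma finite_partitions: "finite {p. is_partition p \<and> sum_list p = n}"
proof (rule finite_subset)
  show "{p. is_partition p \<and> sum_list p = n} \<subseteq> {p. set p \<subseteq> {..n} \<and> length p \<le> n}"
  proof (clarify, intro conjI subsetI)
    fix p x assume p: "is_partition p" "n = sum_list p"
    show "x \<in> {..sum_list p}" if "x \<in> set p"
      using member_le_sum_list[OF that] by simp
    have "length p \<le> sum_list p" if "0 \<notin> set p" for p :: "nat list"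
      using that by (induction p) auto
    then show "length p \<le> sum_list p" using p by (simp add: is_partition_def)
  qed
qed (simp add: finite_lists_length_le)

text \<open>The triangular system is solved only at the partitions of \<open>n\<close>. Homogeneity
  settles all other partitions, symmetry the remaining monomials, and monomials containing index 0
  have coefficient 0 on both sides.\<close>

lemma schur_expansion_exists:
  assumes sym: "adj_symmetric F"
    and hom: "\<And>m. F m \<noteq> 0 \<Longrightarrow> Poly_Mapping.lookup m 0 = 0 \<and> weighted_degree (\<lambda>_. 1) m = n"
  shows "\<exists>c. is_schur_expansion F c"
proof -
  define P where "P = {p. is_partition p \<and> sum_list p = n}"
  have fin: "finite P" unfolding P_def by (rule finite_partitions)
  have part: "is_partition p" if "p \<in> P" for p using that by (simp add: P_def)
  have "\<exists>c. \<forall>y\<in>P. F (part_monom y) = (\<Sum>x\<in>P. c x * schur x (part_monom y))"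
    using fin
  proof (rule triangular_system[where w = "\<lambda>p. weighted_degree id (part_monom p)"])
    fix p q assume pq: "p \<in> P" "q \<in> P" "schur p (part_monom q) \<noteq> 0"
    show "p = q \<or> weighted_degree id (part_monom p) < weighted_degree id (part_monom q)"
      using schur_triangular[OF part pq(3)] pq(1,2) part_monom_inject[of q p] part by blast
  qed (use schur_diagonal part in blast)
  then obtain c where c: "\<And>y. y \<in> P \<Longrightarrow> F (part_monom y) = (\<Sum>x\<in>P. c x * schur x (part_monom y))"
    by blast
  define G where "G = (\<lambda>m. \<Sum>x\<in>P. c x * schur x m)"
  have symG: "adj_symmetric G"
    using schur_adj_symmetric part by (simp add: adj_symmetric_def G_def)
  have eq: "F (part_monom p) = G (part_monom p)" if "is_partition p" for p
  proof (cases "p \<in> P")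
    case False
    have "F (part_monom p) = 0" using hom[of "part_monom p"] degree_part_monom[of p] False that by (auto simp: P_def)
    moreover have "schur x (part_monom p) = 0" if "x \<in> P" for x
      using schur_nonzero_degree[of x "part_monom p"] degree_part_monom[of p] False that
        \<open>is_partition p\<close>
      by (auto simp: P_def)
    ultimately show ?thesis by (simp add: G_def)
  qed (simp add: c G_def)
  have FG: "F m = G m" for m
  proof (cases "Poly_Mapping.lookup m 0 = 0")
    case True
    show ?thesis using sym symG eq True by (rule adj_symmetric_eqI)
  next
    case False
    then have "schur x m = 0" for x using schur_nonzero_lookup_0[of x m] by auto
    moreover have "F m = 0" using False hom[of m] by auto
    ultimately show ?thesis by (simp add: G_def)
  qed
  define d where "d = Poly_Mapping.Abs_poly_mapping (\<lambda>p. if p \<in> P then c p else 0)"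
  have d: "Poly_Mapping.lookup d p = (if p \<in> P then c p else 0)" for p
    unfolding d_def using fin by (subst lookup_Abs_poly_mapping) auto
  then have keys: "Poly_Mapping.keys d \<subseteq> P" by (auto simp: in_keys_iff split: if_splits)
  have "F m = (\<Sum>p\<in>Poly_Mapping.keys d. Poly_Mapping.lookup d p * schur p m)" for m
  proof -
    have "F m = (\<Sum>x\<in>P. Poly_Mapping.lookup d x * schur x m)"
      unfolding FG G_def by (intro sum.cong) (auto simp: d)
    also have "\<dots> = (\<Sum>p\<in>Poly_Mapping.keys d. Poly_Mapping.lookup d p * schur p m)"
      using fin keys by (intro sum.mono_neutral_right) (auto simp: in_keys_iff)
    finally show ?thesis .
  qed
  then have "is_schur_expansion F d"
    using keys part by (auto simp: is_schur_expansion_def)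
  then show ?thesis by blast
qed

lemma schur_expansion_superset:
  assumes "is_schur_expansion F c" "finite S" "Poly_Mapping.keys c \<subseteq> S"
  shows "F m = (\<Sum>p\<in>S. Poly_Mapping.lookup c p * schur p m)"
proof -
  have "F m = (\<Sum>p\<in>Poly_Mapping.keys c. Poly_Mapping.lookup c p * schur p m)"
    using assms(1) by (simp add: is_schur_expansion_def)
  also have "\<dots> = (\<Sum>p\<in>S. Poly_Mapping.lookup c p * schur p m)"
    using assms(2,3) by (intro sum.mono_neutral_left) (auto simp: in_keys_iff)
  finally show ?thesis .
qed

text \<open>Induction on the weight: at the monomial of \<open>p\<close>, every other shape that
  could contribute has smaller weight and lies in \<open>S\<close>, so its coefficient is already
  zero and only that of \<open>p\<close> survives. With \<open>UNIV\<close> and the zero series this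
  is uniqueness; with the partitions of first part at least 5 it discards the shapes too wide for
  \<open>Q\<close>.\<close>

lemma schur_expansion_vanish:
  assumes c: "is_schur_expansion F c"
    and up: "\<And>p q. is_partition p \<Longrightarrow> is_partition q \<Longrightarrow> p \<in> S \<Longrightarrow>
      schur q (part_monom p) \<noteq> 0 \<Longrightarrow> q \<in> S"
    and F: "\<And>p. is_partition p \<Longrightarrow> p \<in> S \<Longrightarrow> F (part_monom p) = 0"
    and p: "p \<in> S"
  shows "Poly_Mapping.lookup c p = 0"
  using p
proof (induction "weighted_degree id (part_monom p)" arbitrary: p rule: less_induct)
  case less
  have part: "is_partition q" if "q \<in> Poly_Mapping.keys c" for q
    using c that by (simp add: is_schur_expansion_def)
  show ?case
  proof (rule ccontr)
    assume nz: "Poly_Mapping.lookup c p \<noteq> 0"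
    then have key: "p \<in> Poly_Mapping.keys c" by (simp add: in_keys_iff)
    have "0 = F (part_monom p)" using F[OF part[OF key] less.prems] by simp
    also have "\<dots> = (\<Sum>q\<in>Poly_Mapping.keys c. Poly_Mapping.lookup c q * schur q (part_monom p))"
      by (rule schur_expansion_superset[OF c]) auto
    also have "\<dots> = (\<Sum>q\<in>Poly_Mapping.keys c. if q = p then Poly_Mapping.lookup c p else 0)"
    proof (rule sum.cong)
      fix q assume q: "q \<in> Poly_Mapping.keys c"
      show "Poly_Mapping.lookup c q * schur q (part_monom p) =
          (if q = p then Poly_Mapping.lookup c p else 0)"
      proof (cases "q = p")
        case True
        then show ?thesis using schur_diagonal[OF part[OF key]] by simp
      next
        case False
        then have "part_monom p \<noteq> part_monom q" using part_monom_inject part q key by metis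
        then have "schur q (part_monom p) \<noteq> 0 \<Longrightarrow> weighted_degree id (part_monom q) < weighted_degree id (part_monom p)"
          using schur_triangular[OF part[OF q]] by blast
        then show ?thesis
          using False less.hyps[of q] up[OF part[OF key] part[OF q] less.prems] by auto
      qed
    qed simp
    also have "\<dots> = Poly_Mapping.lookup c p" using key by simp
    finally show False using nz by simp
  qed
qed

lemma schur_expansion_unique:
  assumes "is_schur_expansion F c" "is_schur_expansion F d"
  shows "c = d"
proof -
  let ?S = "Poly_Mapping.keys c \<union> Poly_Mapping.keys d"
  have keys: "Poly_Mapping.keys (c - d) \<subseteq> ?S"
    by (auto simp: in_keys_iff lookup_minus)
  have "is_schur_expansion (\<lambda>_. 0) (c - d)"
    unfolding is_schur_expansion_def
  proof (intro conjI ballI ext)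
    fix p assume "p \<in> Poly_Mapping.keys (c - d)"
    then show "is_partition p" using assms keys by (auto simp: is_schur_expansion_def)
  next
    fix m
    have "(\<Sum>p\<in>Poly_Mapping.keys (c - d). Poly_Mapping.lookup (c - d) p * schur p m) =
        (\<Sum>p\<in>?S. Poly_Mapping.lookup (c - d) p * schur p m)"
      using keys by (intro sum.mono_neutral_left) (auto simp: in_keys_iff)
    also have "\<dots> = (\<Sum>p\<in>?S. Poly_Mapping.lookup c p * schur p m) -
        (\<Sum>p\<in>?S. Poly_Mapping.lookup d p * schur p m)"
      by (simp add: lookup_minus algebra_simps sum_subtractf)
    also have "\<dots> = F m - F m"
      using schur_expansion_superset[OF assms(1), of ?S] schur_expansion_superset[OF assms(2), of ?S]
      by simp
    finally show "0 = (\<Sum>p\<in>Poly_Mapping.keys (c - d). Poly_Mapping.lookup (c - d) p * schur p m)"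
      by simp
  qed
  then have "Poly_Mapping.lookup (c - d) p = 0" for p
    by (rule schur_expansion_vanish[of _ _ UNIV]) auto
  then show ?thesis by (intro poly_mapping_eqI) (simp add: lookup_minus)
qed

lemma schur_coeff_eq:
  assumes "is_schur_expansion F c"
  shows "schur_coeff p F = Poly_Mapping.lookup c p"
proof -
  have "(THE c. is_schur_expansion F c) = c"
    using assms schur_expansion_unique by blast
  then show ?thesis by (simp add: schur_coeff_def)
qed

section \<open>Counting proper colorings\<close>

definition stable :: "('a \<Rightarrow> 'a \<Rightarrow> bool) \<Rightarrow> 'a set \<Rightarrow> bool" where
  "stable R S \<longleftrightarrow> (\<forall>x\<in>S. \<forall>y\<in>S. \<not> R x y)"

text \<open>The color set is a parameter because the recursion removes the color of each completed
  class.\<close>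

definition colorings ::
  "('a \<Rightarrow> 'a \<Rightarrow> bool) \<Rightarrow> 'a set \<Rightarrow> nat set \<Rightarrow> (nat \<Rightarrow> nat) \<Rightarrow> ('a \<Rightarrow> nat) set" where
  "colorings R V C c = {\<kappa> \<in> V \<rightarrow>\<^sub>E C. (\<forall>v\<in>V. \<forall>w\<in>V. R v w \<longrightarrow> \<kappa> v \<noteq> \<kappa> w) \<and>
     (\<forall>k\<in>C. card {v \<in> V. \<kappa> v = k} = c k)}"

definition classes :: "('a \<Rightarrow> 'a \<Rightarrow> bool) \<Rightarrow> 'a set \<Rightarrow> 'a \<Rightarrow> nat \<Rightarrow> 'a set set" where
  "classes R V v n = {S. S \<subseteq> V \<and> v \<in> S \<and> card S = n \<and> stable R S}"

lemma finite_classes: "finite V \<Longrightarrow> finite (classes R V v n)"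
  by (rule finite_subset[of _ "Pow V"]) (auto simp: classes_def)

lemma finite_colorings: "finite V \<Longrightarrow> finite C \<Longrightarrow> finite (colorings R V C c)"
  by (rule finite_subset[of _ "V \<rightarrow>\<^sub>E C"]) (auto simp: colorings_def intro: finite_PiE)

lemma colorings_remove_class:
  assumes "v \<in> V" "\<kappa> \<in> colorings R V C c"
  shows "\<kappa> v \<in> C" "{x \<in> V. \<kappa> x = \<kappa> v} \<in> classes R V v (c (\<kappa> v))"
    "restrict \<kappa> (V - {x \<in> V. \<kappa> x = \<kappa> v}) \<in>
       colorings R (V - {x \<in> V. \<kappa> x = \<kappa> v}) (C - {\<kappa> v}) c"
proof -
  let ?S = "{x \<in> V. \<kappa> x = \<kappa> v}" and ?\<kappa> = "restrict \<kappa> (V - {x \<in> V. \<kappa> x = \<kappa> v})"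
  have C: "\<kappa> x \<in> C" if "x \<in> V" for x using assms(2) that by (auto simp: colorings_def)
  show vC: "\<kappa> v \<in> C" using C assms(1) .
  have "\<not> R x y" if "x \<in> ?S" "y \<in> ?S" for x y
  proof
    assume "R x y"
    moreover have "\<forall>v\<in>V. \<forall>w\<in>V. R v w \<longrightarrow> \<kappa> v \<noteq> \<kappa> w"
      using assms(2) by (simp add: colorings_def)
    ultimately have "\<kappa> x \<noteq> \<kappa> y" using that by blast
    then show False using that by simp
  qed
  then show "?S \<in> classes R V v (c (\<kappa> v))"
    using assms vC by (simp add: colorings_def classes_def stable_def)
  have "?\<kappa> \<in> (V - ?S) \<rightarrow>\<^sub>E (C - {\<kappa> v})" using C by auto
  moreover have "card {x \<in> V - ?S. ?\<kappa> x = k} = c k" if "k \<in> C - {\<kappa> v}" for k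
  proof -
    have "{x \<in> V - ?S. ?\<kappa> x = k} = {x \<in> V. \<kappa> x = k}" using that by auto
    then show ?thesis using that assms(2) by (simp add: colorings_def)
  qed
  moreover have "?\<kappa> x \<noteq> ?\<kappa> y" if "x \<in> V - ?S" "y \<in> V - ?S" "R x y" for x y
    using that assms(2) by (simp add: colorings_def)
  ultimately show "?\<kappa> \<in> colorings R (V - ?S) (C - {\<kappa> v}) c"
    by (simp add: colorings_def)
qed

lemma colorings_add_class:
  assumes "i \<in> C" "S \<in> classes R V v (c i)" "\<kappa> \<in> colorings R (V - S) (C - {i}) c"
  defines "\<mu> \<equiv> (\<lambda>x. if x \<in> S then i else \<kappa> x)"
  shows "\<mu> \<in> colorings R V C c" "{x \<in> V. \<mu> x = i} = S" "restrict \<mu> (V - S) = \<kappa>" "\<mu> v = i"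
proof -
  have S: "S \<subseteq> V" "v \<in> S" "card S = c i" and stable: "\<And>x y. x \<in> S \<Longrightarrow> y \<in> S \<Longrightarrow> \<not> R x y"
    using assms(2) by (auto simp: classes_def stable_def)
  have \<kappa>: "\<kappa> x \<in> C - {i}" if "x \<in> V - S" for x using assms(3) that by (auto simp: colorings_def)
  have undef: "\<kappa> x = undefined" if "x \<notin> V - S" for x
    using assms(3) that by (auto simp: colorings_def)
  show "\<mu> v = i" using S by (simp add: \<mu>_def)
  show class_i: "{x \<in> V. \<mu> x = i} = S" using S \<kappa> by (auto simp: \<mu>_def)
  show "restrict \<mu> (V - S) = \<kappa>"
    using undef by (auto simp: \<mu>_def restrict_def fun_eq_iff)
  have "\<mu> x \<noteq> \<mu> y" if "x \<in> V" "y \<in> V" "R x y" for x y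
    using that \<kappa>[of x] \<kappa>[of y] stable[of x y] assms(3) by (auto simp: \<mu>_def colorings_def)
  moreover have "\<mu> \<in> V \<rightarrow>\<^sub>E C"
    using S undef \<kappa> assms(1) by (auto simp: \<mu>_def PiE_iff extensional_def)
  moreover have "card {x \<in> V. \<mu> x = k} = c k" if "k \<in> C" for k
  proof (cases "k = i")
    case True
    then show ?thesis using class_i S by simp
  next
    case False
    then have "{x \<in> V. \<mu> x = k} = {x \<in> V - S. \<kappa> x = k}" using S by (auto simp: \<mu>_def)
    then show ?thesis using that False assms(3) by (simp add: colorings_def)
  qed
  ultimately show "\<mu> \<in> colorings R V C c" by (simp add: colorings_def)
qed

text \<open>Fixing \<open>v\<close> makes the decomposition unique: a coloring amounts to the color
  of \<open>v\<close>, the class of \<open>v\<close>, and a coloring of the remaining vertices by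
  the remaining colors.\<close>

lemma card_colorings_rec:
  assumes "finite V" "finite C" "v \<in> V"
  shows "card (colorings R V C c) =
    (\<Sum>i\<in>C. \<Sum>S\<in>classes R V v (c i). card (colorings R (V - S) (C - {i}) c))"
proof -
  let ?D = "SIGMA i:C. SIGMA S:classes R V v (c i). colorings R (V - S) (C - {i}) c"
  let ?f = "\<lambda>(i, S, \<kappa>) x. if x \<in> S then i else \<kappa> x"
  let ?g = "\<lambda>\<kappa>. (\<kappa> v, {x \<in> V. \<kappa> x = \<kappa> v}, restrict \<kappa> (V - {x \<in> V. \<kappa> x = \<kappa> v}))"
  have "bij_betw ?f ?D (colorings R V C c)"
  proof (rule bij_betw_byWitness[where f' = ?g])
    have "?g (?f x) = x \<and> ?f x \<in> colorings R V C c" if "x \<in> ?D" for x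
    proof -
      obtain i S \<kappa> where x: "x = (i, S, \<kappa>)" by (cases x) auto
      have a: "i \<in> C" "S \<in> classes R V v (c i)" "\<kappa> \<in> colorings R (V - S) (C - {i}) c"
        using that by (simp_all add: x)
      show ?thesis using colorings_add_class[OF a] by (simp add: x)
    qed
    then show "\<forall>x\<in>?D. ?g (?f x) = x" "?f ` ?D \<subseteq> colorings R V C c" by blast+
    show "\<forall>\<kappa>\<in>colorings R V C c. ?f (?g \<kappa>) = \<kappa>"
      by (auto simp: fun_eq_iff colorings_def PiE_iff extensional_def)
    show "?g ` colorings R V C c \<subseteq> ?D"
      using colorings_remove_class[OF assms(3)] by auto
  qed
  then have "card (colorings R V C c) = card ?D" by (simp add: bij_betw_same_card)
  also have "\<dots> = (\<Sum>i\<in>C. \<Sum>S\<in>classes R V v (c i). card (colorings R (V - S) (C - {i}) c))"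
    using assms(1,2) by (simp add: card_SigmaI finite_classes finite_colorings finite_SigmaI)
  finally show ?thesis .
qed

text \<open>The list \<open>cs\<close> holds the vertices that can still join the class, and
  \<open>rs\<close> those known to stay uncolored; choosing \<open>x\<close> moves its neighbors to
  \<open>rs\<close>. The results are the uncolored remainders, which are the inputs of the next
  search step.\<close>

fun independent_rests :: "('a \<Rightarrow> 'a \<Rightarrow> bool) \<Rightarrow> nat \<Rightarrow> 'a list \<Rightarrow> 'a list \<Rightarrow> 'a list list" where
  "independent_rests R 0 cs rs = [rs @ cs]"
| "independent_rests R (Suc n) [] rs = []"
| "independent_rests R (Suc n) (x # cs) rs =
     independent_rests R n (filter (\<lambda>y. \<not> R x y) cs) (filter (R x) cs @ rs) @
     independent_rests R (Suc n) cs (x # rs)"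

text \<open>Colors with equal class sizes have equal subcounts, so each distinct size is tried once
  and weighted by its multiplicity. The number argument is the number of colors left.\<close>

fun count_colorings :: "('a \<Rightarrow> 'a \<Rightarrow> bool) \<Rightarrow> nat \<Rightarrow> 'a list \<Rightarrow> nat list \<Rightarrow> nat" where
  "count_colorings R 0 vs ms = (if vs = [] then 1 else 0)"
| "count_colorings R (Suc k) [] ms = 0"
| "count_colorings R (Suc k) (v # vs) ms =
     (\<Sum>m\<leftarrow>remdups ms. count_list ms m *
       (\<Sum>r\<leftarrow>independent_rests R (m - 1) (filter (\<lambda>y. \<not> R v y) vs) (filter (R v) vs).
          count_colorings R k r (remove1 m ms)))"

section \<open>Correctness of the search\<close>

lemma stable_insert:
  assumes "symp R" "irreflp R"
  shows "stable R (insert x S) \<longleftrightarrow> stable R S \<and> (\<forall>y\<in>S. \<not> R x y)"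
  using assms by (auto simp: stable_def dest: sympD irreflpD)

lemma stable_subsets_insert:
  assumes sym: "symp R" and irr: "irreflp R" and "finite A" "x \<notin> A"
  shows "{S. S \<subseteq> insert x A \<and> x \<in> S \<and> card S = Suc n \<and> stable R S} =
    insert x ` {S. S \<subseteq> {y \<in> A. \<not> R x y} \<and> card S = n \<and> stable R S}" (is "?L = ?M")
    and "inj_on (insert x) {S. S \<subseteq> {y \<in> A. \<not> R x y} \<and> card S = n \<and> stable R S}"
proof -
  show "inj_on (insert x) {S. S \<subseteq> {y \<in> A. \<not> R x y} \<and> card S = n \<and> stable R S}"
    using assms(4) by (intro inj_onI) (auto simp: insert_eq_iff subset_iff)
  show "?L = ?M"
  proof (intro equalityI subsetI)
    fix S assume S: "S \<in> ?L"
    then have "finite S" using assms(3) finite_subset by (metis (no_types, lifting) finite_insert mem_Collect_eq)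
    then have "card (S - {x}) = n" using S by simp
    moreover have "stable R (S - {x})" "\<forall>y\<in>S. \<not> R x y" using S by (auto simp: stable_def)
    ultimately have "S - {x} \<in> {S. S \<subseteq> {y \<in> A. \<not> R x y} \<and> card S = n \<and> stable R S}"
      using S by auto
    moreover have "S = insert x (S - {x})" using S by auto
    ultimately show "S \<in> ?M" by blast
  next
    fix S assume "S \<in> ?M"
    then obtain S' where S': "S' \<subseteq> {y \<in> A. \<not> R x y}" "card S' = n" "stable R S'" "S = insert x S'"
      by blast
    then have "finite S'" "x \<notin> S'" using assms(3,4) finite_subset[of S' A] by auto
    then show "S \<in> ?L" using S' by (auto simp: stable_insert[OF sym irr])
  qed
qed

text \<open>The two recursive branches are the stable sets containing the head vertex and those
  avoiding it. The function \<open>h\<close> of the uncolored remainder stands for the next level of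
  the search.\<close>

lemma sum_independent_rests:
  assumes sym: "symp R" and irr: "irreflp R"
    and "distinct cs" "set cs \<inter> set rs = {}"
  shows "(\<Sum>r\<leftarrow>independent_rests R n cs rs. h (set r)) =
    (\<Sum>S | S \<subseteq> set cs \<and> card S = n \<and> stable R S. h ((set cs \<union> set rs) - S))"
  using assms
proof (induction R n cs rs rule: independent_rests.induct)
  case (1 R cs rs)
  have "{S. S \<subseteq> set cs \<and> card S = 0 \<and> stable R S} = {{}}"
    using finite_subset[OF _ finite_set, of _ cs] by (auto simp: stable_def)
  then show ?case by (simp add: Un_commute)
next
  case (2 R n rs)
  have "{S. S \<subseteq> set [] \<and> card S = Suc n \<and> stable R S} = {}" by auto
  then show ?case by (simp only:) simp
next
  case (3 R n x cs rs)
  note sym = 3(3) and irr = 3(4)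
  let ?U = "set (x # cs) \<union> set rs" and ?N = "{y \<in> set cs. \<not> R x y}"
  let ?A = "{S. S \<subseteq> ?N \<and> card S = n \<and> stable R S}"
  let ?B = "{S. S \<subseteq> set cs \<and> card S = Suc n \<and> stable R S}"
  have x: "x \<notin> set cs" "x \<notin> set rs" using 3(5,6) by auto
  have split: "{S. S \<subseteq> set (x # cs) \<and> card S = Suc n \<and> stable R S} =
      {S. S \<subseteq> insert x (set cs) \<and> x \<in> S \<and> card S = Suc n \<and> stable R S} \<union> ?B"
    by auto
  have fin: "finite {S. S \<subseteq> insert x (set cs) \<and> x \<in> S \<and> card S = Suc n \<and> stable R S}"
    by (rule finite_subset[of _ "Pow (insert x (set cs))"]) auto
  have "(\<Sum>S | S \<subseteq> set (x # cs) \<and> card S = Suc n \<and> stable R S. h (?U - S)) =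
      (\<Sum>S | S \<subseteq> insert x (set cs) \<and> x \<in> S \<and> card S = Suc n \<and> stable R S. h (?U - S)) +
      (\<Sum>S\<in>?B. h (?U - S))"
    unfolding split
  proof (rule sum.union_disjoint[OF fin])
    show "finite ?B" by (rule finite_subset[of _ "Pow (set cs)"]) auto
  qed (use x in auto)
  also have "(\<Sum>S | S \<subseteq> insert x (set cs) \<and> x \<in> S \<and> card S = Suc n \<and> stable R S. h (?U - S)) =
      (\<Sum>S\<in>?A. h (?U - insert x S))"
    unfolding stable_subsets_insert(1)[OF sym irr finite_set x(1)]
    by (simp only: sum.reindex[OF stable_subsets_insert(2)[OF sym irr finite_set x(1)]] o_def)
  also have "(\<Sum>S\<in>?A. h (?U - insert x S)) =
      (\<Sum>r\<leftarrow>independent_rests R n (filter (\<lambda>y. \<not> R x y) cs) (filter (R x) cs @ rs). h (set r))"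
  proof -
    have "?U - insert x S = (?N \<union> set (filter (R x) cs @ rs)) - S" for S
      using x by auto
    moreover have "set (filter (\<lambda>y. \<not> R x y) cs) = ?N" by auto
    moreover have "set (filter (\<lambda>y. \<not> R x y) cs) \<inter> set (filter (R x) cs @ rs) = {}"
      using 3(6) by auto
    moreover have "distinct (filter (\<lambda>y. \<not> R x y) cs)" using 3(5) by simp
    ultimately show ?thesis
      using 3(1)[OF sym irr] by (simp only:)
  qed
  also have "(\<Sum>S\<in>?B. h (?U - S)) =
      (\<Sum>r\<leftarrow>independent_rests R (Suc n) cs (x # rs). h (set r))"
    using 3(2)[OF sym irr] 3(5,6) by auto
  finally show ?case by simp
qed

lemma independent_rests_props:
  assumes "r \<in> set (independent_rests R n cs rs)" "distinct (cs @ rs)"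
  shows "distinct r \<and> set r \<subseteq> set cs \<union> set rs"
  using assms
proof (induction R n cs rs rule: independent_rests.induct)
  case (3 R n x cs rs)
  from 3(3) consider
      "r \<in> set (independent_rests R n (filter (\<lambda>y. \<not> R x y) cs) (filter (R x) cs @ rs))"
    | "r \<in> set (independent_rests R (Suc n) cs (x # rs))" by auto
  then show ?case
  proof cases
    case 1
    then show ?thesis using 3(1)[OF 1] 3(4) by auto
  next
    case 2
    then show ?thesis using 3(2)[OF 2] 3(4) by auto
  qed
qed auto

lemma sum_classes:
  assumes sym: "symp R" and irr: "irreflp R"
    and "distinct (v # vs)" "0 < m"
  shows "(\<Sum>S\<in>classes R (set (v # vs)) v m. h (set (v # vs) - S)) =
    (\<Sum>r\<leftarrow>independent_rests R (m - 1) (filter (\<lambda>y. \<not> R v y) vs) (filter (R v) vs). h (set r))"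
proof -
  obtain n where m: "m = Suc n" using assms(4) by (cases m) auto
  have v: "v \<notin> set vs" using assms(3) by simp
  let ?N = "{y \<in> set vs. \<not> R v y}"
  let ?A = "{S. S \<subseteq> ?N \<and> card S = n \<and> stable R S}"
  have "(\<Sum>S\<in>classes R (set (v # vs)) v m. h (set (v # vs) - S)) =
      (\<Sum>S\<in>?A. h (set (v # vs) - insert v S))"
    unfolding classes_def m list.set(2)
    unfolding stable_subsets_insert(1)[OF sym irr finite_set v]
    by (simp only: sum.reindex[OF stable_subsets_insert(2)[OF sym irr finite_set v]] o_def)
  also have "\<dots> = (\<Sum>S\<in>?A. h ((?N \<union> set (filter (R v) vs)) - S))"
  proof -
    have "set (v # vs) - insert v S = (?N \<union> set (filter (R v) vs)) - S" for S
      using v by auto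
    then show ?thesis by simp
  qed
  also have "\<dots> = (\<Sum>r\<leftarrow>independent_rests R n (filter (\<lambda>y. \<not> R v y) vs) (filter (R v) vs). h (set r))"
  proof -
    have "set (filter (\<lambda>y. \<not> R v y) vs) \<inter> set (filter (R v) vs) = {}" by auto
    moreover have "set (filter (\<lambda>y. \<not> R v y) vs) = ?N" by auto
    ultimately show ?thesis
      using sum_independent_rests[OF sym irr, where cs = "filter (\<lambda>y. \<not> R v y) vs"
          and rs = "filter (R v) vs" and n = n and h = h] assms(3)
      by (simp only: distinct_filter distinct.simps)
  qed
  finally show ?thesis by (simp add: m)
qed

text \<open>Positive sizes are essential: every search step gives its color to a vertex, so a color
  with an empty class could never be used up.\<close>

lemma card_colorings:
  assumes sym: "symp R" and irr: "irreflp R"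
    and "distinct vs" "finite C" "card C = k" "\<And>i. i \<in> C \<Longrightarrow> 0 < c i"
    and "mset ms = image_mset c (mset_set C)"
  shows "card (colorings R (set vs) C c) = count_colorings R k vs ms"
  using assms(3-)
proof (induction k arbitrary: vs C ms)
  case 0
  then have C: "C = {}" by simp
  show ?case
  proof (cases vs)
    case Nil
    then show ?thesis by (simp add: C colorings_def)
  next
    case (Cons v vs')
    have "colorings R (set vs) C c = {}" by (auto simp: C Cons colorings_def)
    then show ?thesis by (simp add: Cons)
  qed
next
  case (Suc k)
  show ?case
  proof (cases vs)
    case Nil
    obtain i where i: "i \<in> C" using Suc.prems(3) by fastforce
    have "colorings R (set vs) C c = {}"
      using i Suc.prems(4)[OF i] by (auto simp: Nil colorings_def)
    then show ?thesis by (simp add: Nil)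
  next
    case (Cons v vs')
    let ?rests = "\<lambda>m. independent_rests R (m - 1) (filter (\<lambda>y. \<not> R v y) vs') (filter (R v) vs')"
    let ?g = "\<lambda>m. \<Sum>r\<leftarrow>?rests m. count_colorings R k r (remove1 m ms)"
    have dist: "distinct (filter (\<lambda>y. \<not> R v y) vs' @ filter (R v) vs')"
      using Suc.prems(1) by (auto simp: Cons)
    have "card (colorings R (set vs) C c) =
        (\<Sum>i\<in>C. \<Sum>S\<in>classes R (set vs) v (c i). card (colorings R (set vs - S) (C - {i}) c))"
      by (rule card_colorings_rec) (use Suc.prems in \<open>auto simp: Cons\<close>)
    also have "\<dots> = (\<Sum>i\<in>C. \<Sum>r\<leftarrow>?rests (c i). card (colorings R (set r) (C - {i}) c))"
    proof (rule sum.cong[OF refl])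
      fix i assume i: "i \<in> C"
      show "(\<Sum>S\<in>classes R (set vs) v (c i). card (colorings R (set vs - S) (C - {i}) c)) =
          (\<Sum>r\<leftarrow>?rests (c i). card (colorings R (set r) (C - {i}) c))"
        unfolding Cons
        by (rule sum_classes[OF sym irr]) (use Suc.prems i in \<open>auto simp: Cons\<close>)
    qed
    also have "\<dots> = (\<Sum>i\<in>C. ?g (c i))"
    proof (rule sum.cong[OF refl], intro arg_cong[where f = sum_list] map_cong refl)
      fix i r assume i: "i \<in> C" and r: "r \<in> set (?rests (c i))"
      have "mset (remove1 (c i) ms) = image_mset c (mset_set (C - {i}))"
        using i Suc.prems(2,5) by (simp add: mset_set_Diff image_mset_Diff)
      then show "card (colorings R (set r) (C - {i}) c) = count_colorings R k r (remove1 (c i) ms)"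
        using independent_rests_props[OF r dist] i Suc.prems by (intro Suc.IH) auto
    qed
    \<comment> \<open>The summand depends on a color only through its class size, so the sum can be
      taken over the multiset of sizes and then grouped by equal sizes.\<close>
    also have "\<dots> = sum_list (map ?g ms)"
    proof -
      have "(\<Sum>i\<in>C. ?g (c i)) = sum_mset (image_mset ?g (image_mset c (mset_set C)))"
        by (simp add: sum_unfold_sum_mset image_mset.compositionality o_def)
      also have "\<dots> = sum_mset (mset (map ?g ms))" by (simp add: Suc.prems(5))
      finally show ?thesis by (simp only: sum_mset_sum_list)
    qed
    also have "\<dots> = (\<Sum>m\<in>set ms. count_list ms m * ?g m)"
      by (rule sum_list_map_eq_sum_count)
    also have "\<dots> = (\<Sum>m\<leftarrow>remdups ms. count_list ms m * ?g m)"
      by (subst sum_list_distinct_conv_sum_set) auto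
    finally show ?thesis by (simp add: Cons)
  qed
qed

lemma independent_rests_map:
  "independent_rests R n (map f cs) (map f rs) =
    map (map f) (independent_rests (\<lambda>x y. R (f x) (f y)) n cs rs)"
proof (induction "\<lambda>x y. R (f x) (f y)" n cs rs rule: independent_rests.induct)
  case (3 n x cs rs)
  then show ?case by (simp add: filter_map o_def)
qed auto

text \<open>Moves the search from the vertices, which are sets of numbers, to their indices, where
  adjacency is a table lookup.\<close>

lemma count_colorings_map:
  "count_colorings R k (map f vs) ms = count_colorings (\<lambda>x y. R (f x) (f y)) k vs ms"
proof (induction k arbitrary: vs ms)
  case (Suc k)
  show ?case
    by (cases vs) (simp_all add: filter_map o_def independent_rests_map Suc.IH)
qed simp

section \<open>Chromatic coefficients as coloring counts\<close>

definition adjacent :: "'a graph \<Rightarrow> 'a \<Rightarrow> 'a \<Rightarrow> bool" where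
  "adjacent G v w \<longleftrightarrow> {v, w} \<in> edges G"

lemma adjacent_sym: "adjacent G v w \<Longrightarrow> adjacent G w v"
  by (simp add: adjacent_def insert_commute)

lemma proper_colorings_content:
  assumes "finite (verts G)" "\<And>v w. adjacent G v w \<Longrightarrow> v \<in> verts G \<and> w \<in> verts G"
  shows "{\<kappa> \<in> proper_colorings G. monom_of \<kappa> (verts G) = part_monom p} =
    colorings (adjacent G) (verts G) {1..length p} (\<lambda>k. p ! (k - 1))"
proof (intro equalityI subsetI)
  fix \<kappa> assume "\<kappa> \<in> {\<kappa> \<in> proper_colorings G. monom_of \<kappa> (verts G) = part_monom p}"
  then have k: "\<kappa> \<in> proper_colorings G" and m: "monom_of \<kappa> (verts G) = part_monom p" by auto
  have c: "card {v \<in> verts G. \<kappa> v = k} = (if 0 < k \<and> k \<le> length p then p ! (k - 1) else 0)" for k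
    using lookup_part_monom[of p k] by (simp add: lookup_monom_of assms(1) flip: m)
  have "\<kappa> v \<in> {1..length p}" if "v \<in> verts G" for v
  proof (rule ccontr)
    assume "\<kappa> v \<notin> {1..length p}"
    then have "card {w \<in> verts G. \<kappa> w = \<kappa> v} = 0" by (auto simp: c)
    then show False using that assms(1) by (subst (asm) card_0_eq) auto
  qed
  then show "\<kappa> \<in> colorings (adjacent G) (verts G) {1..length p} (\<lambda>k. p ! (k - 1))"
    using k c by (auto simp: colorings_def proper_colorings_def PiE_iff adjacent_def)
next
  fix \<kappa> assume k: "\<kappa> \<in> colorings (adjacent G) (verts G) {1..length p} (\<lambda>k. p ! (k - 1))"
  have "monom_of \<kappa> (verts G) = part_monom p"
  proof (rule poly_mapping_eqI)
    fix j
    show "Poly_Mapping.lookup (monom_of \<kappa> (verts G)) j = Poly_Mapping.lookup (part_monom p) j"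
    proof (cases "j \<in> {1..length p}")
      case True
      then show ?thesis using k by (auto simp: lookup_monom_of assms(1) lookup_part_monom colorings_def)
    next
      case False
      have "{v \<in> verts G. \<kappa> v = j} = {}"
        using k False by (auto simp: colorings_def PiE_iff)
      then show ?thesis using False
        by (simp only: lookup_monom_of[OF assms(1)] lookup_part_monom card.empty) auto
    qed
  qed
  moreover have "\<kappa> \<in> verts G \<rightarrow>\<^sub>E {0<..}" using k by (force simp: colorings_def PiE_iff)
  moreover have "\<kappa> v \<noteq> \<kappa> w" if "{v, w} \<in> edges G" for v w
    using k that assms(2)[of v w] by (simp add: colorings_def adjacent_def)
  ultimately show "\<kappa> \<in> {\<kappa> \<in> proper_colorings G. monom_of \<kappa> (verts G) = part_monom p}"
    by (simp add: proper_colorings_def)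
qed

text \<open>Exchanging the colors \<open>i\<close> and \<open>Suc i\<close> is an involution on
  proper colorings; \<open>restrict\<close> keeps the recolored function extensional, and
  \<open>0 < i\<close> keeps its colors positive.\<close>

lemma chromatic_adj_symmetric:
  assumes fin: "finite (verts G)"
    and edge: "\<And>v w. adjacent G v w \<Longrightarrow> v \<in> verts G \<and> w \<in> verts G"
  shows "adj_symmetric (chromatic_symmetric_function G)"
  unfolding adj_symmetric_def
proof (intro allI impI)
  fix i :: nat and m :: monomial assume i: "0 < i"
  let ?t = "transpose i (Suc i)"
  let ?P = "\<lambda>m. {\<kappa> \<in> proper_colorings G. monom_of \<kappa> (verts G) = m}"
  let ?f = "\<lambda>\<kappa>. restrict (?t \<circ> \<kappa>) (verts G)"
  have teq: "?t x = k \<longleftrightarrow> x = ?t k" for x k by (metis transpose_involutory)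
  have mon: "monom_of (?f \<kappa>) (verts G) = swap_vars i (monom_of \<kappa> (verts G))" for \<kappa>
  proof (rule poly_mapping_eqI)
    fix k
    have "{v \<in> verts G. ?f \<kappa> v = k} = {v \<in> verts G. \<kappa> v = ?t k}"
      using teq by auto
    then show "Poly_Mapping.lookup (monom_of (?f \<kappa>) (verts G)) k =
        Poly_Mapping.lookup (swap_vars i (monom_of \<kappa> (verts G))) k"
      by (simp only: lookup_monom_of[OF fin] lookup_swap_vars)
  qed
  have pos: "0 < ?t k" if "0 < k" for k using i that by (simp add: transpose_def)
  have proper: "?f \<kappa> \<in> proper_colorings G" if "\<kappa> \<in> proper_colorings G" for \<kappa>
  proof -
    have "?f \<kappa> v \<noteq> ?f \<kappa> w" if "{v, w} \<in> edges G" for v w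
    proof -
      have "v \<in> verts G" "w \<in> verts G" using edge[of v w] that by (simp_all add: adjacent_def)
      moreover have "\<kappa> v \<noteq> \<kappa> w"
        using that \<open>\<kappa> \<in> proper_colorings G\<close> by (simp add: proper_colorings_def)
      ultimately show ?thesis by (simp add: teq)
    qed
    moreover have "?f \<kappa> \<in> verts G \<rightarrow>\<^sub>E {0<..}"
      using that pos by (auto simp: proper_colorings_def PiE_iff)
    ultimately show ?thesis by (simp add: proper_colorings_def)
  qed
  have inv: "?f (?f \<kappa>) = \<kappa>" if "\<kappa> \<in> proper_colorings G" for \<kappa>
    using that by (auto simp: proper_colorings_def PiE_iff extensional_def fun_eq_iff)
  have "bij_betw ?f (?P (swap_vars i m)) (?P m)"
    by (rule bij_betw_byWitness[where f' = ?f]) (use mon proper inv in auto)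
  then show "chromatic_symmetric_function G (swap_vars i m) = chromatic_symmetric_function G m"
    by (simp add: chromatic_symmetric_function_def bij_betw_same_card)
qed

lemma chromatic_homogeneous:
  assumes "finite (verts G)" "chromatic_symmetric_function G m \<noteq> 0"
  shows "Poly_Mapping.lookup m 0 = 0 \<and> weighted_degree (\<lambda>_. 1) m = card (verts G)"
proof -
  have "{\<kappa> \<in> proper_colorings G. monom_of \<kappa> (verts G) = m} \<noteq> {}"
  proof
    assume "{\<kappa> \<in> proper_colorings G. monom_of \<kappa> (verts G) = m} = {}"
    then show False using assms(2) unfolding chromatic_symmetric_function_def
      by (simp only: card.empty)
  qed
  then obtain \<kappa> where k: "\<kappa> \<in> proper_colorings G" and m: "m = monom_of \<kappa> (verts G)" by blast
  have "{v \<in> verts G. \<kappa> v = 0} = {}" using k by (fastforce simp: proper_colorings_def PiE_iff)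
  then show ?thesis using assms(1) by (simp add: m lookup_monom_of weighted_degree_monom_of)
qed

section \<open>The graph \<open>Q\<close>\<close>

declare One_nat_def [simp del]

text \<open>Indices start at 0, so index 3 is \<open>u_4\<close> and index 12 is the added vertex
  \<open>u_13\<close>. The value \<open>{0}\<close> beyond the range is not a vertex of
  \<open>Q\<close>, which makes the adjacency table correct for all indices.\<close>

definition vertex :: "nat \<Rightarrow> nat set" where
  "vertex i = (if i < 13 then [{1, 8}, {7, 10}, {2, 7}, {4, 5}, {4, 9}, {3, 6}, {6, 10}, {3, 10},
     {5, 9}, {8, 10}, {8, 9}, {7, 9}, {}] ! i else {0})"

definition neighbours :: "nat \<Rightarrow> nat list" where
  "neighbours i = (if i < 13 then [[9, 10], [2, 6, 7, 9, 11], [1, 11], [4, 8, 12], [3, 8, 10, 11, 12],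
     [6, 7], [1, 5, 7, 9], [1, 5, 6, 9], [3, 4, 10, 11, 12], [0, 1, 6, 7, 10], [0, 4, 8, 9, 11, 12],
     [1, 2, 4, 8, 10, 12], [3, 4, 8, 10, 11]] ! i else [])"

lemma less_13_cases: "i < 13 \<Longrightarrow> i \<in> {0, 1, 2, 3, 4, 5, 6, 7, 8, 9, 10, 11, 12}" for i :: nat
  by simp presburger

lemma vertex_simps [simp]:
  "vertex 0 = {1, 8}" "vertex 1 = {7, 10}" "vertex 2 = {2, 7}" "vertex 3 = {4, 5}"
  "vertex 4 = {4, 9}" "vertex 5 = {3, 6}" "vertex 6 = {6, 10}" "vertex 7 = {3, 10}"
  "vertex 8 = {5, 9}" "vertex 9 = {8, 10}" "vertex 10 = {8, 9}" "vertex 11 = {7, 9}" "vertex 12 = {}"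
  by (simp_all add: vertex_def)

lemma neighbours_simps [simp]:
  "neighbours 0 = [9, 10]" "neighbours 1 = [2, 6, 7, 9, 11]" "neighbours 2 = [1, 11]"
  "neighbours 3 = [4, 8, 12]" "neighbours 4 = [3, 8, 10, 11, 12]" "neighbours 5 = [6, 7]"
  "neighbours 6 = [1, 5, 7, 9]" "neighbours 7 = [1, 5, 6, 9]" "neighbours 8 = [3, 4, 10, 11, 12]"
  "neighbours 9 = [0, 1, 6, 7, 10]" "neighbours 10 = [0, 4, 8, 9, 11, 12]"
  "neighbours 11 = [1, 2, 4, 8, 10, 12]" "neighbours 12 = [3, 4, 8, 10, 11]"
  by (simp_all add: neighbours_def)

lemma adjacent_Q:
  "adjacent Q v w \<longleftrightarrow>
     v \<in> edges H1 \<and> w \<in> edges H1 \<and> v \<noteq> w \<and> v \<inter> w \<noteq> {} \<or>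
     v = {} \<and> w \<in> {{4, 5}, {4, 9}, {5, 9}, {8, 9}, {7, 9}} \<or>
     w = {} \<and> v \<in> {{4, 5}, {4, 9}, {5, 9}, {8, 9}, {7, 9}}"
proof -
  have "{v, w} \<in> {{e, f} | e f. e \<in> edges H1 \<and> f \<in> edges H1 \<and> e \<noteq> f \<and> e \<inter> f \<noteq> {}} \<longleftrightarrow>
      v \<in> edges H1 \<and> w \<in> edges H1 \<and> v \<noteq> w \<and> v \<inter> w \<noteq> {}"
    by (auto simp: doubleton_eq_iff)
  moreover have "{v, w} \<in> {{{}, x} | x. x \<in> N} \<longleftrightarrow> v = {} \<and> w \<in> N \<or> w = {} \<and> v \<in> N" for N
    by (auto simp: doubleton_eq_iff)
  ultimately show ?thesis
    unfolding adjacent_def Q_def add_vertex_def G1_def line_graph_def graph.sel Un_iff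
    by (simp only: )
qed

lemma atMost_12: "{..<13} = {0, 1, 2, 3, 4, 5, 6, 7, 8, 9, 10, 11, 12 :: nat}"
  using less_13_cases by auto

lemma verts_Q_edges: "verts Q = insert {} (edges H1)"
  by (simp add: Q_def add_vertex_def G1_def line_graph_def)

lemma verts_Q: "verts Q = vertex ` {..<13}"
  unfolding verts_Q_edges atMost_12 image_insert image_empty vertex_simps
  by (simp add: H1_def insert_commute)

lemma ball_13: "(\<forall>i<13. P i) \<longleftrightarrow> (\<forall>i\<in>{0, 1, 2, 3, 4, 5, 6, 7, 8, 9, 10, 11, 12 :: nat}. P i)"
  unfolding atMost_12[symmetric] by auto

lemma adjacent_vertex_table:
  "\<forall>i<13. \<forall>j<13. adjacent Q (vertex i) (vertex j) \<longleftrightarrow> j \<in> set (neighbours i)"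
  unfolding ball_13 adjacent_Q
  by (simp add: H1_def doubleton_eq_iff)

lemma adjacent_Q_verts: "adjacent Q v w \<Longrightarrow> v \<in> verts Q \<and> w \<in> verts Q"
  unfolding verts_Q_edges by (auto simp: adjacent_Q H1_def)

lemma finite_verts_Q: "finite (verts Q)"
  by (simp add: verts_Q)

text \<open>Free of range conditions, the equivalence can rewrite the relation passed to
  \<open>count_colorings\<close>, where the indices are bound.\<close>

lemma adjacent_vertex: "adjacent Q (vertex i) (vertex j) \<longleftrightarrow> j \<in> set (neighbours i)"
proof (cases "i < 13 \<and> j < 13")
  case True
  then show ?thesis using adjacent_vertex_table by blast
next
  case False
  have "{0} \<notin> verts Q" unfolding verts_Q_edges by (auto simp: H1_def)
  moreover have "vertex i = {0} \<or> vertex j = {0}" using False by (auto simp: vertex_def)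
  ultimately have "\<not> adjacent Q (vertex i) (vertex j)" using adjacent_Q_verts by metis
  moreover have "j \<notin> set (neighbours i)"
  proof
    assume j: "j \<in> set (neighbours i)"
    then have i: "i < 13" by (auto simp: neighbours_def split: if_splits)
    from less_13_cases[OF i] j have "j < 13" by (elim insertE emptyE) auto
    then show False using False i by simp
  qed
  ultimately show ?thesis by simp
qed

lemma inj_vertex: "inj_on vertex {..<13}"
  unfolding atMost_12 by (simp add: doubleton_eq_iff)

section \<open>A row of the inverse Kostka matrix\<close>

fun bounded_partitions :: "nat \<Rightarrow> nat \<Rightarrow> nat \<Rightarrow> nat list list" where
  "bounded_partitions 0 m n = (if n = 0 then [[]] else [])"
| "bounded_partitions (Suc l) m n = (if n = 0 then [[]] else
     concat (map (\<lambda>a. map ((#) a) (bounded_partitions l a (n - a))) [1..<Suc (min m n)]))"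

lemma bounded_partitions_complete:
  assumes "is_partition p" "length p \<le> l" "\<forall>x\<in>set p. x \<le> m" "sum_list p = n"
  shows "p \<in> set (bounded_partitions l m n)"
  using assms
proof (induction l arbitrary: p m n)
  case 0
  then show ?case by simp
next
  case (Suc l)
  show ?case
  proof (cases p)
    case Nil
    then show ?thesis using Suc.prems by simp
  next
    case (Cons a q)
    then have "q \<in> set (bounded_partitions l a (n - a))"
      using Suc.prems by (intro Suc.IH) (auto simp: is_partition_def)
    moreover have "0 < a" "a \<le> m" "a \<le> n"
      using Suc.prems by (auto simp: Cons is_partition_def)
    ultimately show ?thesis by (auto simp: Cons simp del: upt_Suc)
  qed
qed

text \<open>Nine partitions of 13 have at most five parts, all at most 4. The Kostka matrix on them
  is unitriangular, so back substitution determines the weights. The two shapes left out, 43222 and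
  33322, do not dominate 33331 and get weight 0.\<close>

definition shape_weights :: "(int \<times> nat list) list" where
  "shape_weights = [(1, [3, 3, 3, 3, 1]), (-3, [4, 3, 3, 2, 1]), (-1, [4, 3, 3, 3]),
     (1, [4, 4, 2, 2, 1]), (2, [4, 4, 3, 1, 1]), (2, [4, 4, 3, 2]), (-2, [4, 4, 4, 1])]"

lemma inverse_kostka:
  "\<forall>p\<in>set (bounded_partitions 5 4 13). (\<Sum>(a, q)\<leftarrow>shape_weights. a * int (kostka p (rev q))) =
     (if p = [3, 3, 3, 3, 1] then 1 else 0)"
  by code_simp

section \<open>Connectedness, claws and line graphs\<close>

lemma connected_Q: "connected_graph Q"
proof -
  let ?R = "(adj_rel Q)\<^sup>*"
  have edge: "(vertex i, vertex j) \<in> adj_rel Q" if "j \<in> set (neighbours i)" for i j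
    using adjacent_vertex[of i j] that by (simp add: adj_rel_def adjacent_def)
  have r: "(vertex 10, vertex j) \<in> ?R" if "(vertex 10, vertex i) \<in> ?R" "j \<in> set (neighbours i)" for i j
    using that(1) edge[OF that(2)] by (rule rtrancl_into_rtrancl)
  \<comment> \<open>Index 10 is the edge \<open>{8, 9}\<close> of \<open>H1\<close>. Its neighbors
    9, 4 and 11, together with 7 (a neighbor of 9), reach every vertex.\<close>
  have r10: "(vertex 10, vertex j) \<in> ?R" if "j \<in> set (neighbours 10)" for j
    using r[of 10] that by blast
  have r9: "(vertex 10, vertex j) \<in> ?R" if "j \<in> set (neighbours 9)" for j
    using r[OF r10 that] by simp
  have r4: "(vertex 10, vertex j) \<in> ?R" if "j \<in> set (neighbours 4)" for j
    using r[OF r10 that] by simp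
  have r11: "(vertex 10, vertex j) \<in> ?R" if "j \<in> set (neighbours 11)" for j
    using r[OF r10 that] by simp
  have r7: "(vertex 10, vertex j) \<in> ?R" if "j \<in> set (neighbours 7)" for j
    using r[OF r9 that] by simp
  have "(vertex 10, vertex j) \<in> ?R" if "j < 13" for j
  proof -
    have "j \<in> set (neighbours 10) \<union> set (neighbours 9) \<union> set (neighbours 4) \<union>
        set (neighbours 11) \<union> set (neighbours 7)"
      using less_13_cases[OF that] by (elim insertE emptyE) simp_all
    then show ?thesis using r10 r9 r4 r11 r7 by blast
  qed
  then have root: "(vertex 10, v) \<in> ?R" if "v \<in> verts Q" for v
    using that by (auto simp: verts_Q)
  have "sym (adj_rel Q)" by (auto simp: sym_def adj_rel_def insert_commute)
  then have "sym ?R" by (rule sym_rtrancl)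
  then have "(v, w) \<in> ?R" if "v \<in> verts Q" "w \<in> verts Q" for v w
    using root that by (meson rtrancl_trans symD)
  moreover have "verts Q \<noteq> {}" by (simp add: verts_Q_edges)
  ultimately show ?thesis by (simp add: connected_graph_def)
qed

lemma no_three_independent_neighbours:
  "\<forall>i<13. \<forall>a\<in>set (neighbours i). \<forall>b\<in>set (neighbours i). \<forall>c\<in>set (neighbours i).
     a \<noteq> b \<and> a \<noteq> c \<and> b \<noteq> c \<longrightarrow>
       b \<in> set (neighbours a) \<or> c \<in> set (neighbours a) \<or> c \<in> set (neighbours b)"
  unfolding ball_13 by simp

lemma claw_free_Q: "claw_free Q"
  unfolding claw_free_def
proof
  assume "\<exists>S. S \<subseteq> verts Q \<and> graph_isomorphic (induced_subgraph Q S) K13"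
  then obtain S and f :: "nat set \<Rightarrow> nat" where S: "S \<subseteq> verts Q" and bij: "bij_betw f S {0, 1, 2, 3}"
    and iso: "\<And>v w. v \<in> S \<Longrightarrow> w \<in> S \<Longrightarrow> adjacent Q v w \<longleftrightarrow> {f v, f w} \<in> {{0, 1}, {0, 2}, {0, 3}}"
    by (auto simp: graph_isomorphic_def induced_subgraph_def K13_def adjacent_def)
  have "\<exists>i<13. vertex i \<in> S \<and> f (vertex i) = k" if "k \<in> {0, 1, 2, 3}" for k
  proof -
    have "k \<in> f ` S" using bij that by (simp add: bij_betw_def)
    then obtain v where "v \<in> S" "f v = k" by blast
    then show ?thesis using S by (auto simp: verts_Q)
  qed
  then obtain x where x: "\<And>k. k \<in> {0, 1, 2, 3} \<Longrightarrow> x k < 13 \<and> vertex (x k) \<in> S \<and> f (vertex (x k)) = k"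
    by metis
  have adj: "x l \<in> set (neighbours (x k)) \<longleftrightarrow> {k, l} \<in> {{0, 1}, {0, 2}, {0, 3}}"
    if "k \<in> {0, 1, 2, 3}" "l \<in> {0, 1, 2, 3}" for k l
    using iso[of "vertex (x k)" "vertex (x l)"] x[OF that(1)] x[OF that(2)] adjacent_vertex by simp
  have neq: "x k \<noteq> x l" if "k \<in> {0, 1, 2, 3}" "l \<in> {0, 1, 2, 3}" "k \<noteq> l" for k l
    using x[OF that(1)] x[OF that(2)] that(3) by metis
  \<comment> \<open>\<open>x 0\<close> is the center of the supposed claw, and \<open>x 1\<close>,
    \<open>x 2\<close>, \<open>x 3\<close> are its leaves.\<close>
  have "x 1 \<in> set (neighbours (x 0))" "x 2 \<in> set (neighbours (x 0))" "x 3 \<in> set (neighbours (x 0))"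
    "x 2 \<notin> set (neighbours (x 1))" "x 3 \<notin> set (neighbours (x 1))" "x 3 \<notin> set (neighbours (x 2))"
    "x 0 < 13"
    using x[of 0] by (simp_all add: adj doubleton_eq_iff)
  moreover have "x 1 \<noteq> x 2" "x 1 \<noteq> x 3" "x 2 \<noteq> x 3" by (simp_all add: neq)
  ultimately show False using no_three_independent_neighbours by blast
qed

text \<open>In a complete bipartite graph with parts of size 2, at most two edges pairwise intersect.\<close>

lemma K5_minus_edge_not_line:
  assumes card: "card a = 2" "card b = 2" "card x = 2" "card y = 2" "card z = 2"
    and "a \<inter> b = {}" "x \<inter> a \<noteq> {}" "x \<inter> b \<noteq> {}" "y \<inter> a \<noteq> {}" "y \<inter> b \<noteq> {}"
      "z \<inter> a \<noteq> {}" "z \<inter> b \<noteq> {}"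
    and "x \<inter> y \<noteq> {}" "x \<inter> z \<noteq> {}" "y \<inter> z \<noteq> {}" "x \<noteq> y" "x \<noteq> z" "y \<noteq> z"
  shows False
proof -
  have pair: "\<exists>s\<in>a. \<exists>t\<in>b. u = {s, t}" if "card u = 2" "u \<inter> a \<noteq> {}" "u \<inter> b \<noteq> {}" for u
  proof -
    obtain s t where st: "s \<in> u" "s \<in> a" "t \<in> u" "t \<in> b"
      using \<open>u \<inter> a \<noteq> {}\<close> \<open>u \<inter> b \<noteq> {}\<close> by blast
    have "s \<noteq> t" using st assms(6) by blast
    then have "{s, t} = u" using st that(1)
      by (intro card_subset_eq) (auto intro: card_ge_0_finite)
    then show ?thesis using st by blast
  qed
  obtain p q r s where a: "a = {p, q}" and b: "b = {r, s}"
    using card by (auto simp: card_2_iff)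
  obtain x1 x2 where x: "x1 \<in> a" "x2 \<in> b" "x = {x1, x2}" using pair[of x] assms by blast
  obtain y1 y2 where y: "y1 \<in> a" "y2 \<in> b" "y = {y1, y2}" using pair[of y] assms by blast
  obtain z1 z2 where z: "z1 \<in> a" "z2 \<in> b" "z = {z1, z2}" using pair[of z] assms by blast
  have dis: "s \<noteq> t" if "s \<in> a" "t \<in> b" for s t using that assms(6) by blast
  \<comment> \<open>The pairs are points of a two-by-two grid. Distinct pairs that meet share
    exactly one coordinate, but among any three points of the grid two are opposite corners.\<close>
  have xy: "x1 = y1 \<or> x2 = y2" and xz: "x1 = z1 \<or> x2 = z2" and yz: "y1 = z1 \<or> y2 = z2"
    using assms(13-15) x y z dis by blast+
  have "x1 = y1 \<longrightarrow> x2 \<noteq> y2" "x1 = z1 \<longrightarrow> x2 \<noteq> z2" "y1 = z1 \<longrightarrow> y2 \<noteq> z2"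
    using assms(16-18) x y z by auto
  then show False using xy xz yz x(1,2) y(1,2) z(1,2) a b by auto
qed

lemma not_line_graph_Q: "\<not> is_line_graph Q"
proof
  assume "is_line_graph Q"
  then obtain H :: "nat graph" and f where H: "simple_graph H"
    and bij: "bij_betw f (verts Q) (edges H)"
    and iso: "\<And>v w. v \<in> verts Q \<Longrightarrow> w \<in> verts Q \<Longrightarrow>
      adjacent Q v w \<longleftrightarrow> {f v, f w} \<in> {{e, f} | e f. e \<in> edges H \<and> f \<in> edges H \<and> e \<noteq> f \<and> e \<inter> f \<noteq> {}}"
    by (auto simp: is_line_graph_def graph_isomorphic_def line_graph_def adjacent_def)
  define e where "e i = f (vertex i)" for i
  have vQ: "vertex i \<in> verts Q" if "i < 13" for i using that by (auto simp: verts_Q)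
  have eH: "e i \<in> edges H" if "i < 13" for i
    using bij vQ[OF that] by (auto simp: e_def bij_betw_def)
  have card: "card (e i) = 2" if "i < 13" for i using H eH[OF that] by (simp add: simple_graph_def)
  have neq: "e i \<noteq> e j" if "i < 13" "j < 13" "i \<noteq> j" for i j
  proof
    assume "e i = e j"
    then have "vertex i = vertex j"
      using bij vQ[OF that(1)] vQ[OF that(2)] by (auto simp: e_def bij_betw_def dest: inj_onD)
    then show False using inj_vertex that by (auto dest: inj_onD)
  qed
  have adj: "j \<in> set (neighbours i) \<longleftrightarrow> e i \<inter> e j \<noteq> {}" if "i < 13" "j < 13" "i \<noteq> j" for i j
  proof -
    have "j \<in> set (neighbours i) \<longleftrightarrow> adjacent Q (vertex i) (vertex j)" by (simp add: adjacent_vertex)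
    also have "\<dots> \<longleftrightarrow> {e i, e j} \<in> {{e, f} | e f. e \<in> edges H \<and> f \<in> edges H \<and> e \<noteq> f \<and> e \<inter> f \<noteq> {}}"
      unfolding e_def by (rule iso[OF vQ[OF that(1)] vQ[OF that(2)]])
    also have "\<dots> \<longleftrightarrow> e i \<inter> e j \<noteq> {}"
      using eH[OF that(1)] eH[OF that(2)] neq[OF that] by (auto simp: doubleton_eq_iff)
    finally show ?thesis .
  qed
  \<comment> \<open>Indices 3 and 10 are the ends of the missing edge; 4, 8 and 12 are adjacent to
    both of them and to each other.\<close>
  have "e 3 \<inter> e 10 = {}" using adj[of 3 10] by simp
  then show False
    by (intro K5_minus_edge_not_line[of "e 3" "e 10" "e 4" "e 8" "e 12"])
      (simp_all add: card neq flip: adj)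
qed

section \<open>Evaluation of the coloring counts\<close>

definition nbr :: "nat \<Rightarrow> nat \<Rightarrow> bool" where
  "nbr i j \<longleftrightarrow> j \<in> set (neighbours i)"

text \<open>One list equation per vertex splits, by injectivity of the list constructor, into
  thirteen rewrite rules; the whole table yields 169.\<close>

lemma nbr_rows:
  "map (nbr 0) [0, 1, 2, 3, 4, 5, 6, 7, 8, 9, 10, 11, 12] =
    [False, False, False, False, False, False, False,
     False, False, True, True, False, False]"
  "map (nbr 1) [0, 1, 2, 3, 4, 5, 6, 7, 8, 9, 10, 11, 12] =
    [False, False, True, False, False, False, True,
     True, False, True, False, True, False]"
  "map (nbr 2) [0, 1, 2, 3, 4, 5, 6, 7, 8, 9, 10, 11, 12] =
    [False, True, False, False, False, False, False,
     False, False, False, False, True, False]"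
  "map (nbr 3) [0, 1, 2, 3, 4, 5, 6, 7, 8, 9, 10, 11, 12] =
    [False, False, False, False, True, False, False,
     False, True, False, False, False, True]"
  "map (nbr 4) [0, 1, 2, 3, 4, 5, 6, 7, 8, 9, 10, 11, 12] =
    [False, False, False, True, False, False, False,
     False, True, False, True, True, True]"
  "map (nbr 5) [0, 1, 2, 3, 4, 5, 6, 7, 8, 9, 10, 11, 12] =
    [False, False, False, False, False, False, True,
     True, False, False, False, False, False]"
  "map (nbr 6) [0, 1, 2, 3, 4, 5, 6, 7, 8, 9, 10, 11, 12] =
    [False, True, False, False, False, True, False,
     True, False, True, False, False, False]"
  "map (nbr 7) [0, 1, 2, 3, 4, 5, 6, 7, 8, 9, 10, 11, 12] =
    [False, True, False, False, False, True, True,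
     False, False, True, False, False, False]"
  "map (nbr 8) [0, 1, 2, 3, 4, 5, 6, 7, 8, 9, 10, 11, 12] =
    [False, False, False, True, True, False, False,
     False, False, False, True, True, True]"
  "map (nbr 9) [0, 1, 2, 3, 4, 5, 6, 7, 8, 9, 10, 11, 12] =
    [True, True, False, False, False, False, True,
     True, False, False, True, False, False]"
  "map (nbr 10) [0, 1, 2, 3, 4, 5, 6, 7, 8, 9, 10, 11, 12] =
    [True, False, False, False, True, False, False,
     False, True, True, False, True, True]"
  "map (nbr 11) [0, 1, 2, 3, 4, 5, 6, 7, 8, 9, 10, 11, 12] =
    [False, True, True, False, True, False, False,
     False, True, False, True, False, True]"
  "map (nbr 12) [0, 1, 2, 3, 4, 5, 6, 7, 8, 9, 10, 11, 12] =
    [False, False, False, True, True, False, False,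
     False, True, False, True, True, False]"
  by (simp_all add: nbr_def)

lemmas nbr_table = nbr_rows[unfolded list.map list.inject]

lemmas count_simps = nbr_table count_colorings.simps independent_rests.simps
  filter.simps append.simps list.map sum_list.Nil sum_list.Cons count_list.simps
  remove1.simps remdups.simps list.set insert_iff empty_iff if_True if_False
  not_True_eq_False not_False_eq_True simp_thms list.distinct nat.distinct nat.inject
  add_0_left mult_0_right mult_0 mult_1 mult_1_right diff_Suc_1
  one_add_one numeral_plus_one one_plus_numeral add_num_simps mult_num_simps arith_simps rel_simps

text \<open>Class sizes are unary so that the recursion equations apply, and vertices of large degree
  come first to keep the search tree small.\<close>

abbreviation "vertex_order \<equiv> [10, 11, 1, 4, 8, 9, 12, 6, 7, 3, 0, 2, 5 :: nat]"
abbreviation "n1 \<equiv> Suc 0"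
abbreviation "n2 \<equiv> Suc n1"
abbreviation "n3 \<equiv> Suc n2"
abbreviation "n4 \<equiv> Suc n3"
abbreviation "n5 \<equiv> Suc n4"

lemma count_33331: "count_colorings nbr n5 vertex_order [n3, n3, n3, n3, n1] = 4032"
  by (simp only: count_simps)

lemma count_43321: "count_colorings nbr n5 vertex_order [n4, n3, n3, n2, n1] = 1584"
  by (simp only: count_simps)

text \<open>Four colors never suffice, because 4, 8, 10, 11 and 12 are pairwise adjacent. The other
  counts with four class sizes vanish for the same reason.\<close>

lemma count_4333: "count_colorings nbr n4 vertex_order [n4, n3, n3, n3] = 0"
  by (simp only: count_simps)

lemma count_44221: "count_colorings nbr n5 vertex_order [n4, n4, n2, n2, n1] = 576"
  by (simp only: count_simps)

text \<open>Each of the five classes contains exactly one of the pairwise adjacent vertices 4, 8,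
  10, 11, 12. The two singleton classes are thus used up there, and three colors remain for 1, 6, 7,
  9, which are pairwise adjacent.\<close>

lemma count_44311: "count_colorings nbr n5 vertex_order [n4, n4, n3, n1, n1] = 0"
  by (simp only: count_simps)

lemma count_4432: "count_colorings nbr n4 vertex_order [n4, n4, n3, n2] = 0"
  by (simp only: count_simps)

lemma count_4441: "count_colorings nbr n4 vertex_order [n4, n4, n4, n1] = 0"
  by (simp only: count_simps)

section \<open>The Schur coefficient\<close>

text \<open>In terms of \<open>H1\<close>, clique 0 is the triangle on 4, 5, 9 together with the
  added vertex, cliques 1 and 2 consist of the edges at 8 and at 7, and clique 3 is the triangle on
  3, 6, 10.\<close>

definition clique_index :: "nat \<Rightarrow> nat" where
  "clique_index i = (if i < 13 then [1, 2, 2, 0, 0, 3, 3, 3, 0, 1, 1, 2, 0] ! i else 0)"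

lemma clique_cover:
  "\<forall>i<13. \<forall>j<13. i \<noteq> j \<and> clique_index i = clique_index j \<longrightarrow> j \<in> set (neighbours i)"
  "\<forall>i<13. clique_index i < 4"
  unfolding ball_13 by (simp_all add: clique_index_def)

lemma chromatic_Q_large_part:
  assumes "p \<noteq> []" "5 \<le> hd p"
  shows "chromatic_symmetric_function Q (part_monom p) = 0"
proof -
  have "monom_of \<kappa> (verts Q) \<noteq> part_monom p" if k: "\<kappa> \<in> proper_colorings Q" for \<kappa>
  proof
    assume m: "monom_of \<kappa> (verts Q) = part_monom p"
    \<comment> \<open>The class of color 1 in terms of indices; it meets each of the four cliques at
      most once.\<close>
    let ?I = "{i \<in> {..<13}. \<kappa> (vertex i) = 1}"
    have "hd p = Poly_Mapping.lookup (part_monom p) 1"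
      using assms(1) by (cases p) (simp_all add: lookup_part_monom)
    also have "\<dots> = card {v \<in> verts Q. \<kappa> v = 1}"
      by (simp add: lookup_monom_of finite_verts_Q flip: m)
    also have "{v \<in> verts Q. \<kappa> v = 1} = vertex ` ?I" by (auto simp: verts_Q)
    also have "card (vertex ` ?I) = card ?I"
      by (intro card_image inj_on_subset[OF inj_vertex]) auto
    also have "\<dots> \<le> card {..<4::nat}"
    proof (rule card_inj_on_le)
      show "inj_on clique_index ?I"
      proof (rule inj_onI)
        fix i j assume ij: "i \<in> ?I" "j \<in> ?I" "clique_index i = clique_index j"
        show "i = j"
        proof (rule ccontr)
          assume "i \<noteq> j"
          then have "adjacent Q (vertex i) (vertex j)"
            using ij clique_cover(1) by (simp add: adjacent_vertex)
          then have "\<kappa> (vertex i) \<noteq> \<kappa> (vertex j)"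
            using k unfolding proper_colorings_def adjacent_def by blast
          then show False using ij by simp
        qed
      qed
    qed (use clique_cover(2) in auto)
    finally show False using assms(2) by simp
  qed
  then have "{\<kappa> \<in> proper_colorings Q. monom_of \<kappa> (verts Q) = part_monom p} = {}" by blast
  then show ?thesis unfolding chromatic_symmetric_function_def by (simp only: card.empty of_nat_0)
qed

lemma irreflp_adjacent_Q: "irreflp (adjacent Q)"
  by (auto intro!: irreflpI simp: adjacent_Q)

lemma symp_adjacent: "symp (adjacent G)"
  by (auto intro: sympI adjacent_sym)

lemma chromatic_Q_part_monom:
  assumes "0 \<notin> set p" "length p = k" "count_colorings nbr k vertex_order p = n"
  shows "chromatic_symmetric_function Q (part_monom p) = int n"
proof -
  let ?c = "\<lambda>k. p ! (k - 1)"
  have order: "set vertex_order = {..<13}" unfolding atMost_12 by auto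
  have set: "set (map vertex vertex_order) = verts Q"
    unfolding set_map order verts_Q ..
  have "distinct vertex_order" by simp
  then have distinct: "distinct (map vertex vertex_order)"
    unfolding distinct_map order using inj_vertex by blast
  have "map ?c [1..<Suc (length p)] = p"
    by (rule nth_equalityI) (auto simp del: upt_Suc)
  then have "mset p = image_mset ?c (mset [1..<Suc (length p)])"
    by (metis mset_map)
  also have "mset [1..<Suc (length p)] = mset_set {1..length p}"
    by (simp only: mset_upt atLeastLessThanSuc_atLeastAtMost)
  finally have mset: "mset p = image_mset ?c (mset_set {1..length p})" .
  have pos: "0 < ?c k" if "k \<in> {1..length p}" for k
  proof -
    have "?c k \<in> set p" using that by auto
    then show ?thesis using assms(1) by (cases "?c k = 0") auto
  qed
  have "card (colorings (adjacent Q) (verts Q) {1..length p} ?c) =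
      count_colorings (adjacent Q) (length p) (map vertex vertex_order) p"
    unfolding set[symmetric]
    by (rule card_colorings[OF symp_adjacent irreflp_adjacent_Q distinct]) (use mset pos in auto)
  also have "\<dots> = count_colorings nbr (length p) vertex_order p"
    unfolding count_colorings_map adjacent_vertex nbr_def[abs_def] ..
  finally have count: "card (colorings (adjacent Q) (verts Q) {1..length p} ?c) =
      count_colorings nbr (length p) vertex_order p" .
  have "{\<kappa> \<in> proper_colorings Q. monom_of \<kappa> (verts Q) = part_monom p} =
      colorings (adjacent Q) (verts Q) {1..length p} ?c"
    using finite_verts_Q adjacent_Q_verts by (rule proper_colorings_content)
  then show ?thesis
    unfolding chromatic_symmetric_function_def by (simp only: count[unfolded assms(2,3)] assms(2))
qed

text \<open>Only three of the seven coefficients are nonzero, and 4032 - 3 * 1584 + 576 =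
  -144.\<close>

lemma chromatic_Q_values:
  "(\<Sum>(a, q)\<leftarrow>shape_weights. a * chromatic_symmetric_function Q (part_monom q)) = -144"
proof -
  have n: "Suc 0 = 1" "Suc 1 = 2" "Suc 2 = 3" "Suc 3 = 4" by simp_all
  have "chromatic_symmetric_function Q (part_monom [n3, n3, n3, n3, n1]) = int 4032"
    "chromatic_symmetric_function Q (part_monom [n4, n3, n3, n2, n1]) = int 1584"
    "chromatic_symmetric_function Q (part_monom [n4, n3, n3, n3]) = int 0"
    "chromatic_symmetric_function Q (part_monom [n4, n4, n2, n2, n1]) = int 576"
    "chromatic_symmetric_function Q (part_monom [n4, n4, n3, n1, n1]) = int 0"
    "chromatic_symmetric_function Q (part_monom [n4, n4, n3, n2]) = int 0"
    "chromatic_symmetric_function Q (part_monom [n4, n4, n4, n1]) = int 0"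
    by (rule chromatic_Q_part_monom[OF _ _ count_33331] chromatic_Q_part_monom[OF _ _ count_43321]
        chromatic_Q_part_monom[OF _ _ count_4333] chromatic_Q_part_monom[OF _ _ count_44221]
        chromatic_Q_part_monom[OF _ _ count_44311] chromatic_Q_part_monom[OF _ _ count_4432]
        chromatic_Q_part_monom[OF _ _ count_4441]; simp)+
  note vals = this[unfolded n]
  show ?thesis
    unfolding shape_weights_def by (simp only: list.map sum_list.Cons sum_list.Nil prod.case vals)
qed

theorem proposition4p1:
  "connected_graph Q \<and> claw_free Q \<and> \<not> is_line_graph Q \<and>
   schur_coeff [3, 3, 3, 3, 1] (chromatic_symmetric_function Q) = -144"
proof -
  let ?F = "chromatic_symmetric_function Q" and ?B = "set (bounded_partitions 5 4 13)"
  have "adj_symmetric ?F"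
    using finite_verts_Q adjacent_Q_verts by (rule chromatic_adj_symmetric)
  then have "\<exists>c. is_schur_expansion ?F c"
    using chromatic_homogeneous[OF finite_verts_Q] by (rule schur_expansion_exists)
  then obtain c where c: "is_schur_expansion ?F c" by blast
  have part: "is_partition p" if "Poly_Mapping.lookup c p \<noteq> 0" for p
    using c that by (simp add: is_schur_expansion_def in_keys_iff)
  have vanish: "Poly_Mapping.lookup c p = 0" if "p \<noteq> []" "5 \<le> hd p" for p
  proof (rule schur_expansion_vanish[OF c, of "{p. p \<noteq> [] \<and> 5 \<le> hd p}"])
    fix p q assume "is_partition q" "p \<in> {p. p \<noteq> [] \<and> 5 \<le> hd p}" "schur q (part_monom p) \<noteq> 0"
    then show "q \<in> {p. p \<noteq> [] \<and> 5 \<le> hd p}"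
      using schur_part_monom_nonzero(2)[of q p] by auto
  qed (use that chromatic_Q_large_part in auto)
  have expand: "?F (part_monom q) = (\<Sum>p\<in>?B. Poly_Mapping.lookup c p * int (kostka p (rev q)))"
    if q: "length q \<le> 5" "sum_list q = 13" for q
  proof -
    let ?U = "?B \<union> Poly_Mapping.keys c"
    have "?F (part_monom q) = (\<Sum>p\<in>?U. Poly_Mapping.lookup c p * schur p (part_monom q))"
      by (rule schur_expansion_superset[OF c]) auto
    also have "\<dots> = (\<Sum>p\<in>?B. Poly_Mapping.lookup c p * schur p (part_monom q))"
    proof (rule sum.mono_neutral_right)
      \<comment> \<open>A contributing shape has at most five rows because \<open>q\<close> does,
        size 13 by homogeneity, and parts at most 4 by \<open>vanish\<close>, so the enumeration
        contains it.\<close>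
      show "\<forall>p\<in>?U - ?B. Poly_Mapping.lookup c p * schur p (part_monom q) = 0"
      proof (rule ballI, rule ccontr)
        fix p assume p: "p \<in> ?U - ?B" and "Poly_Mapping.lookup c p * schur p (part_monom q) \<noteq> 0"
        then have c0: "Poly_Mapping.lookup c p \<noteq> 0" and s0: "schur p (part_monom q) \<noteq> 0" by auto
        have "length p \<le> 5" using schur_part_monom_nonzero(1)[OF part[OF c0] s0] q by simp
        moreover have "sum_list p = 13"
          using schur_nonzero_degree[OF s0] degree_part_monom[of q] q by simp
        moreover have "x \<le> 4" if "x \<in> set p" for x
        proof -
          have "x \<le> hd p" using that part[OF c0] by (cases p) (auto simp: is_partition_def)
          moreover have "hd p < 5" using vanish[of p] c0 that by (cases p) force+
          ultimately show ?thesis by simp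
        qed
        ultimately have "p \<in> ?B" using part[OF c0] by (intro bounded_partitions_complete) auto
        then show False using p by simp
      qed
    qed auto
    also have "\<dots> = (\<Sum>p\<in>?B. Poly_Mapping.lookup c p * int (kostka p (rev q)))"
    proof (rule sum.cong[OF refl])
      fix p
      \<comment> \<open>The Kostka formula applies to partitions; any other list has coefficient 0
        in \<open>c\<close>.\<close>
      show "Poly_Mapping.lookup c p * schur p (part_monom q) =
          Poly_Mapping.lookup c p * int (kostka p (rev q))"
        using part[of p] schur_part_monom[of p q] by (cases "Poly_Mapping.lookup c p = 0") auto
    qed
    finally show ?thesis .
  qed
  have weights: "length (snd w) \<le> 5 \<and> sum_list (snd w) = 13" if "w \<in> set shape_weights" for w
    using that by (auto simp: shape_weights_def)
  have "-144 = (\<Sum>(a, q)\<leftarrow>shape_weights. a * ?F (part_monom q))"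
    by (rule chromatic_Q_values[symmetric])
  also have "\<dots> = (\<Sum>(a, q)\<leftarrow>shape_weights. \<Sum>p\<in>?B. Poly_Mapping.lookup c p * (a * int (kostka p (rev q))))"
    using weights by (intro arg_cong[where f = sum_list] map_cong)
      (auto simp: expand sum_distrib_left algebra_simps)
  also have "\<dots> = (\<Sum>p\<in>?B. Poly_Mapping.lookup c p * (\<Sum>(a, q)\<leftarrow>shape_weights. a * int (kostka p (rev q))))"
  proof -
    have "(\<Sum>(a, q)\<leftarrow>ws. \<Sum>p\<in>?B. Poly_Mapping.lookup c p * (a * int (kostka p (rev q)))) =
        (\<Sum>p\<in>?B. Poly_Mapping.lookup c p * (\<Sum>(a, q)\<leftarrow>ws. a * int (kostka p (rev q))))" for ws
      by (induction ws) (auto simp: sum.distrib algebra_simps)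
    then show ?thesis .
  qed
  \<comment> \<open>By the choice of the weights the inner sum is a Kronecker delta, which cancels
    every coefficient but the wanted one.\<close>
  also have "\<dots> = (\<Sum>p\<in>?B. if p = [3, 3, 3, 3, 1] then Poly_Mapping.lookup c p else 0)"
    using inverse_kostka by (intro sum.cong) auto
  also have "\<dots> = Poly_Mapping.lookup c [3, 3, 3, 3, 1]"
  proof -
    have "[3, 3, 3, 3, 1] \<in> ?B"
      by (rule bounded_partitions_complete) (simp_all add: is_partition_def)
    then show ?thesis by simp
  qed
  finally show ?thesis
    using connected_Q claw_free_Q not_line_graph_Q schur_coeff_eq[OF c] by simp
qed

end
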